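(* Let $\mathfrak{q}=(q_i)_{i\ge 0}$ be a gap sequence such that, for some $q\ge 0$ and $0\le\beta<1$, $Q_k=\sum_{i=0}^{k-1}q_i=qk+O(k^\beta)$ as $k\to\infty$. Then for every $t_0>0$ and any $\varepsilon>0$ and $\delta>0$, $$\limsup_{n\to\infty} n^{\delta-1/2}\log\nu_n^{\mathfrak{q}}\Bigl\{\lambda\in\Lambda_{\mathfrak{q}}(n)\colon \sup_{t\ge t_0}\bigl|z_nY_\lambda(t/z_n)-\varphi_{T_q}(t;q)\bigr|>\varepsilon\Bigr\}<0,$$ where $z_n=\vartheta_q/\sqrt n$.
   Context: A partition is a sequence of integers $\lambda_1\ge\lambda_2\ge\dots\ge0$ with finitely many nonzero terms; $N(\lambda)=\sum_i\lambda_i$ is its weight and $K(\lambda)=\#\{i:\lambda_i>0\}$ its length. A gap sequence $\mathfrak{q}=(q_i)_{i\ge0}$ is a sequence of non-negative integers with $q_0\ge1$. $\Lambda_{\mathfrak{q}}$ is the set of all partitions $\lambda$ such that, with $k=K(\lambda)$, $\lambda_i-\lambda_{i+1}\ge q_{k-i}$ for $i=1,\dots,k$ (the empty partition is included). $\Lambda_{\mathfrak{q}}(n)=\{\lambda\in\Lambda_{\mathfrak{q}}: N(\lambda)=n\}$ and $\nu_n^{\mathfrak{q}}$ is the uniform probability measure on $\Lambda_{\mathfrak{q}}(n)$ (defined whenever this set is non-empty). $Y_\lambda(t)=\lambda_{\lfloor t\rfloor+1}$ for $t\ge0$. Convention: $\log0=-\infty$. For $q>0$, $T_q>0$ is the unique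 solution of $e^{-qT_q}=1-e^{-T_q}$; $T_0=+\infty$. $\varphi_{T_q}(t;q)=-qt-\log(1-e^{-t})$ for $0<t\le T_q$ and $\varphi_{T_q}(t;q)=0$ for $t\ge T_q$ (so $\varphi_{T_0}(t;0)=-\log(1-e^{-t})$ for all $t>0$). $\mathrm{Li}_2(x)=\sum_{k\ge1}x^k/k^2$ for $0\le x\le1$. For $q>0$, $\vartheta_q>0$ is given by $\vartheta_q^2=\tfrac12 qT_q^2+\mathrm{Li}_2(1-e^{-T_q})$; $\vartheta_0=\pi/\sqrt6$. *)

theory Defs
  imports "HOL-Probability.Probability" "HOL-Real_Asymp.Real_Asymp"
begin

text \<open>A partition is encoded as a function \<open>nat \<Rightarrow> nat\<close> indexed from 0,
  so that \<open>p i\<close> is the part written \<open>\<lambda>\<^sub>i\<^sub>+\<^sub>1\<close> in the usual indexing from 1.\<close>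

definition is_partition :: "(nat \<Rightarrow> nat) \<Rightarrow> bool" where
  "is_partition p \<longleftrightarrow> antimono p \<and> finite {i. p i > 0}"

definition part_weight :: "(nat \<Rightarrow> nat) \<Rightarrow> nat" where
  "part_weight p = (\<Sum>i | p i > 0. p i)"

definition part_length :: "(nat \<Rightarrow> nat) \<Rightarrow> nat" where
  "part_length p = card {i. p i > 0}"

definition gap_sequence :: "(nat \<Rightarrow> nat) \<Rightarrow> bool" where
  "gap_sequence qs \<longleftrightarrow> qs 0 \<ge> 1"

text \<open>With \<open>k\<close> the length, the condition \<open>\<lambda>\<^sub>i - \<lambda>\<^sub>i\<^sub>+\<^sub>1 \<ge> q\<^sub>k\<^sub>-\<^sub>i\<close> for \<open>1 \<le> i \<le> k\<close> becomes,
  at \<open>i = j + 1\<close>, the condition below for \<open>j < k\<close>; it is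
  written additively to avoid truncated subtraction of parts.\<close>

definition gap_partitions :: "(nat \<Rightarrow> nat) \<Rightarrow> (nat \<Rightarrow> nat) set" where
  "gap_partitions qs =
     {p. is_partition p \<and>
         (\<forall>j<part_length p. p j \<ge> p (Suc j) + qs (part_length p - Suc j))}"

definition gap_partitions_of :: "(nat \<Rightarrow> nat) \<Rightarrow> nat \<Rightarrow> (nat \<Rightarrow> nat) set" where
  "gap_partitions_of qs n = {p \<in> gap_partitions qs. part_weight p = n}"

text \<open>\<open>pmf_of_set\<close> is the uniform distribution only on finite non-empty sets; see
  \<open>finite_gap_partitions_of\<close> and \<open>gap_partitions_of_nonempty\<close> below.\<close>

definition gap_measure :: "(nat \<Rightarrow> nat) \<Rightarrow> nat \<Rightarrow> (nat \<Rightarrow> nat) pmf" where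
  "gap_measure qs n = pmf_of_set (gap_partitions_of qs n)"

text \<open>\<open>Y\<^sub>\<lambda>(t) = \<lambda>\<^sub>\<lfloor>\<^sub>t\<^sub>\<rfloor>\<^sub>+\<^sub>1\<close> for \<open>t \<ge> 0\<close>.\<close>

definition young_boundary :: "(nat \<Rightarrow> nat) \<Rightarrow> real \<Rightarrow> real" where
  "young_boundary p t = real (p (nat \<lfloor>t\<rfloor>))"

definition T_root :: "real \<Rightarrow> real" where
  "T_root q = (THE T. T > 0 \<and> exp (- q * T) = 1 - exp (- T))"

definition T_end :: "real \<Rightarrow> ereal" where
  "T_end q = (if q = 0 then \<infinity> else ereal (T_root q))"

definition limit_shape :: "real \<Rightarrow> real \<Rightarrow> real" where
  "limit_shape q t = (if ereal t \<le> T_end q then - q * t - ln (1 - exp (- t)) else 0)"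

definition Li2 :: "real \<Rightarrow> real" where
  "Li2 x = (\<Sum>k. x ^ Suc k / real (Suc k) ^ 2)"

definition theta :: "real \<Rightarrow> real" where
  "theta q = (if q = 0 then pi / sqrt 6
              else sqrt (q * (T_root q)\<^sup>2 / 2 + Li2 (1 - exp (- T_root q))))"

definition ereal_log :: "real \<Rightarrow> ereal" where
  "ereal_log x = (if x = 0 then -\<infinity> else ereal (ln x))"

lemma T_root_ex1:
  fixes q :: real
  assumes "q > 0"
  shows "\<exists>!T. T > 0 \<and> exp (- q * T) = 1 - exp (- T)"
proof -
  define g where "g = (\<lambda>T. exp (- q * T) + exp (- T))"
  have mono: "g y < g x" if "x < y" for x y
    unfolding g_def using assms that by (intro add_strict_mono) simp_all
  have g0: "g 0 = 2"
    by (simp add: g_def)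
  have "(g \<longlongrightarrow> 0 + 0) at_top"
    unfolding g_def
  proof (intro tendsto_add)
    show "((\<lambda>T. exp (- q * T)) \<longlongrightarrow> 0) at_top"
      using assms by real_asymp
    show "((\<lambda>T::real. exp (- T)) \<longlongrightarrow> 0) at_top"
      by real_asymp
  qed
  then have "eventually (\<lambda>T. g T < 1) at_top"
    by (auto dest!: order_tendstoD(2)[where a = 1])
  then have "eventually (\<lambda>T. g T < 1 \<and> T > 0) at_top"
    using eventually_gt_at_top by (rule eventually_conj)
  then obtain M where M: "g M < 1" "M > 0"
    by (auto dest: eventually_happens)
  have "continuous_on {0..M} g"
    unfolding g_def by (intro continuous_intros)
  then obtain T where T: "0 \<le> T" "T \<le> M" "g T = 1"
    using IVT2'[of g M 1 0] M g0 by auto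
  then have "T > 0"
    using g0 by (cases "T = 0") auto
  show ?thesis
  proof (rule ex1I[of _ T])
    show "T > 0 \<and> exp (- q * T) = 1 - exp (- T)"
      using T \<open>T > 0\<close> by (simp add: g_def)
    fix S assume "S > 0 \<and> exp (- q * S) = 1 - exp (- S)"
    then have "g S = 1"
      by (simp add: g_def)
    then show "S = T"
      using mono[of S T] mono[of T S] T by (cases S T rule: linorder_cases) auto
  qed
qed

lemma finite_gap_partitions_of: "finite (gap_partitions_of qs n)"
proof -
  have "gap_partitions_of qs n \<subseteq>
          {f. \<forall>i. (i \<in> {..<n} \<longrightarrow> f i \<in> {..n}) \<and> (i \<notin> {..<n} \<longrightarrow> f i = 0)}"
  proof
    fix p assume p: "p \<in> gap_partitions_of qs n"
    then have anti: "antimono p" and fin: "finite {i. p i > 0}"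
      and w: "(\<Sum>i | p i > 0. p i) = n"
      by (auto simp: gap_partitions_of_def gap_partitions_def is_partition_def part_weight_def)
    have le: "p i \<le> n" for i
    proof (cases "p i > 0")
      case True
      then show ?thesis
        using member_le_sum[of i "{i. p i > 0}" p] fin w by auto
    qed simp
    have "card {i. p i > 0} \<le> (\<Sum>i | p i > 0. p i)"
      using sum_mono[of "{i. p i > 0}" "\<lambda>_. 1" p] by auto
    then have card: "card {i. p i > 0} \<le> n"
      using w by simp
    have zero: "p i = 0" if "i \<ge> n" for i
    proof (rule ccontr)
      assume "p i \<noteq> 0"
      have "{..i} \<subseteq> {j. p j > 0}"
      proof
        fix j assume "j \<in> {..i}"
        then have "p i \<le> p j"
          using antimonoD[OF anti, of j i] by simp
        then show "j \<in> {j. p j > 0}"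
          using \<open>p i \<noteq> 0\<close> by simp
      qed
      then have "Suc i \<le> card {j. p j > 0}"
        using card_mono[OF fin, of "{..i}"] by simp
      then show False
        using card that by simp
    qed
    show "p \<in> {f. \<forall>i. (i \<in> {..<n} \<longrightarrow> f i \<in> {..n}) \<and> (i \<notin> {..<n} \<longrightarrow> f i = 0)}"
      using le zero by auto
  qed
  then show ?thesis
    by (rule finite_subset) (intro finite_set_of_finite_funs finite_lessThan finite_atMost)
qed

lemma gap_partitions_of_nonempty:
  assumes "gap_sequence qs" "n \<ge> qs 0"
  shows "gap_partitions_of qs n \<noteq> {}"
proof -
  define p where "p = (\<lambda>i::nat. if i = 0 then n else 0)"
  have "n > 0"
    using assms by (simp add: gap_sequence_def)
  then have supp: "{i. p i > 0} = {0}"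
    by (auto simp: p_def)
  have "is_partition p"
    unfolding is_partition_def supp by (simp add: antimono_def) (simp add: p_def)
  moreover have "part_length p = 1" "part_weight p = n"
    unfolding part_length_def part_weight_def supp by (simp_all add: p_def)
  ultimately have "p \<in> gap_partitions_of qs n"
    using assms by (simp add: gap_partitions_of_def gap_partitions_def p_def)
  then show ?thesis by blast
qed

end

theory Submission
  imports Defs
begin

text \<open>
  The proof compares numbers of partitions at exponential scale \<open>exp (const * sqrt n)\<close>.  A large
  deviation argument of Chernoff type gives the bound \<open>exp (- c * sqrt n)\<close> for the probability in
  question, which is more than what is asserted for any \<open>\<delta> > 0\<close>.

  \<^emph>\<open>Generating functions.\<close>  A partition in the class with \<open>k\<close> parts is the minimal one with \<open>k\<close> parts
  plus free differences \<open>r\<^sub>j \<ge> 0\<close>, and its weight is \<open>S\<^sub>k + \<Sum> (j + 1) r\<^sub>j\<close> where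
  \<open>S\<^sub>k = Q\<^sub>1 + \<dots> + Q\<^sub>k\<close>.  Hence the sum of \<open>exp (- z N)\<close> over these partitions is
  \<open>exp (- z S\<^sub>k)\<close> times the product of \<open>1 / (1 - exp (- z j))\<close> over \<open>1 \<le> j \<le> k\<close>.  With \<open>k = x / z\<close> and
  \<open>z \<rightarrow> 0\<close> its logarithm is \<open>(I x - q x\<^sup>2 / 2) / z\<close> to leading order, where \<open>I\<close> is the integral of
  \<open>L t = - ln (1 - exp (- t))\<close>.  The maximum over \<open>x\<close> is attained where \<open>L x = q x\<close>, that is at \<open>T\<^sub>q\<close>,
  and equals \<open>\<vartheta>\<^sub>q\<^sup>2\<close>; for \<open>q = 0\<close> it is the limit \<open>\<pi>\<^sup>2 / 6\<close> at infinity.  So the generating function is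
  \<open>exp (\<vartheta>\<^sub>q\<^sup>2 / z)\<close> to leading order (\<open>total_sum_le\<close>, \<open>total_sum_ge\<close>).

  \<^emph>\<open>One point.\<close>  Multiplying the weights by \<open>exp (a Y(s / z))\<close> replaces \<open>L t\<close> by \<open>L (t - a)\<close> for
  \<open>t > s\<close>.  Completing the square turns the maximisation into the untilted one at the shifted point
  \<open>x - a\<close>, so that the cost of the tilt is only \<open>a (L s - q s)\<close> up to \<open>O(a\<^sup>2)\<close> (\<open>tilted_sum_le\<close>).  As
  \<open>\<phi> s = max 0 (L s - q s)\<close>, a small positive \<open>a\<close> excludes \<open>z Y(s / z) > \<phi> s + \<epsilon>\<close>, and a small negative
  one excludes \<open>z Y(s / z) < \<phi> s - \<epsilon>\<close>; if \<open>\<phi> s > 0\<close>, partitions with fewer than \<open>s / z\<close> parts are excluded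
  because for them \<open>x\<close> stays away from the maximiser.  Monotonicity of \<open>Y\<close> and of the continuous function \<open>\<phi>\<close>
  reduces the supremum over \<open>t \<ge> t\<^sub>0\<close> to finitely many points \<open>s\<close> (\<open>negligible_deviation\<close>).

  \<^emph>\<open>From weights to counting.\<close>  Adding 1 to the largest part shows that the number of partitions of
  \<open>n\<close> in the class does not decrease with \<open>n\<close>.  Since the generating function at parameters near
  \<open>\<vartheta>\<^sub>q / sqrt n\<close> is carried, up to an exponentially small fraction, by weights near \<open>n\<close>, the number
  for \<open>n\<close> is, for large \<open>n\<close>, at least \<open>exp ((2 - \<gamma>) \<vartheta>\<^sub>q sqrt n)\<close> for every \<open>\<gamma> > 0\<close> (\<open>card_gap_partitions_of_ge\<close>).  Bad partitions
  number at most \<open>exp ((2 - c) \<vartheta>\<^sub>q sqrt n)\<close> with some \<open>c > 0\<close>, and \<open>\<gamma> = c / 2\<close> gives the theorem.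
\<close>

section \<open>The dilogarithm and the integral of the Bose logarithm\<close>

definition bose_log :: "real \<Rightarrow> real" where
  "bose_log t = - ln (1 - exp (- t))"

text \<open>The integral of \<^const>\<open>bose_log\<close> from 0 to \<open>x\<close>, as integration by parts gives it.  At \<open>x = T\<^sub>q\<close> this
  form exhibits the dilogarithm value that occurs in the definition of \<^const>\<open>theta\<close>.\<close>

definition bose_int :: "real \<Rightarrow> real" where
  "bose_int x = Li2 (1 - exp (- x)) + x * bose_log x"

lemma summable_inverse_squares_Suc: "summable (\<lambda>k. 1 / real (Suc k) ^ 2)"
  using inverse_squares_sums by (simp add: sums_iff add.commute)

lemma Li2_term_le:
  assumes "0 \<le> x" "x \<le> 1"
  shows "norm (x ^ Suc k / real (Suc k) ^ 2) \<le> 1 / real (Suc k) ^ 2"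
proof -
  have "x ^ Suc k \<le> 1" using assms by (intro power_le_one) auto
  then show ?thesis using assms by (simp add: divide_right_mono del: power_Suc of_nat_Suc)
qed

lemma Li2_nonneg: "0 \<le> x \<Longrightarrow> x \<le> 1 \<Longrightarrow> 0 \<le> Li2 x"
  unfolding Li2_def
  by (intro suminf_nonneg summable_comparison_test'[OF summable_inverse_squares_Suc] Li2_term_le) auto

lemma Li2_0 [simp]: "Li2 0 = 0"
  by (simp add: Li2_def)

lemma Li2_1: "Li2 1 = pi\<^sup>2 / 6"
  using inverse_squares_sums by (simp add: Li2_def sums_iff add.commute)

lemma continuous_on_Li2: "continuous_on {0..1} Li2"
proof -
  have "uniform_limit {0..1} (\<lambda>n x. \<Sum>k<n. x ^ Suc k / real (Suc k) ^ 2) Li2 sequentially"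
    unfolding Li2_def[abs_def]
    by (rule Weierstrass_m_test[OF _ summable_inverse_squares_Suc]) (use Li2_term_le in auto)
  then show ?thesis
    by (rule uniform_limit_theorem[rotated])
       (auto intro!: always_eventually continuous_intros)
qed

lemma Li2_has_derivative:
  assumes "0 < x" "x < 1"
  shows "(Li2 has_real_derivative - ln (1 - x) / x) (at x)"
proof -
  have coeff: "1 / real (Suc n) ^ 2 * real (Suc n) * y ^ n = y ^ n / real (Suc n)" for n and y :: real
    by (simp add: power2_eq_square del: of_nat_Suc)
  have "((\<lambda>x. \<Sum>n. 1 / real (Suc n) ^ 2 * x ^ Suc n) has_real_derivative
          (\<Sum>n. 1 / real (Suc n) ^ 2 * real (Suc n) * x ^ n)) (at x)"
  proof (rule DERIV_power_series')
    show "x \<in> {-1<..<1}" "(0::real) < 1" using assms by auto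
    fix y :: real assume y: "y \<in> {-1<..<1}"
    show "summable (\<lambda>n. 1 / real (Suc n) ^ 2 * real (Suc n) * y ^ n)"
      unfolding coeff
    proof (rule summable_comparison_test'[where g = "\<lambda>n. \<bar>y\<bar> ^ n"])
      show "summable (\<lambda>n. \<bar>y\<bar> ^ n)" using y by (simp add: abs_if)
      fix n :: nat
      have "\<bar>y\<bar> ^ n / real (Suc n) \<le> \<bar>y\<bar> ^ n / 1"
        by (intro divide_left_mono) auto
      then show "norm (y ^ n / real (Suc n)) \<le> \<bar>y\<bar> ^ n" by (simp add: power_abs)
    qed
  qed
  moreover have "(\<Sum>n. 1 / real (Suc n) ^ 2 * real (Suc n) * x ^ n) = - ln (1 - x) / x"
  proof -
    have terms: "(- 1) ^ n * (1 / real (n + 1)) * (1 - x - 1) ^ Suc n = - (x * (x ^ n / real (Suc n)))" for n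
    proof -
      have "(1 - x - 1) ^ Suc n = (- 1) ^ Suc n * x ^ Suc n"
        by (subst power_mult_distrib[symmetric]) simp
      then have eq: "(1 - x - 1) ^ Suc n = - ((- 1) ^ n * x ^ Suc n)"
        by (simp only: power_Suc mult_minus_left mult_1_left)
      have "(- 1) ^ n * (1 / real (n + 1)) * (1 - x - 1) ^ Suc n
          = - (((- 1) ^ n * (- 1) ^ n) * (x ^ Suc n / real (Suc n)))"
        unfolding eq by (simp del: power_Suc)
      also have "(- 1 :: real) ^ n * (- 1) ^ n = 1" by (simp flip: power_mult_distrib)
      finally show ?thesis by simp
    qed
    have "ln (1 - x) = (\<Sum>n. - (x * (x ^ n / real (Suc n))))"
      using ln_series[of "1 - x"] assms unfolding terms by simp
    moreover have S: "summable (\<lambda>n. x ^ n / real (Suc n))"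
    proof (rule summable_comparison_test'[where g = "\<lambda>n. x ^ n"])
      show "summable (\<lambda>n. x ^ n)" using assms by simp
      fix n :: nat
      have "x ^ n / real (Suc n) \<le> x ^ n / 1"
        using assms by (intro divide_left_mono) auto
      then show "norm (x ^ n / real (Suc n)) \<le> x ^ n" using assms by simp
    qed
    ultimately have "ln (1 - x) = - (x * (\<Sum>n. x ^ n / real (Suc n)))"
      using suminf_minus[OF summable_mult[OF S, of x]] suminf_mult[OF S, of x] by simp
    then show ?thesis using assms unfolding coeff by (simp add: field_simps)
  qed
  ultimately show ?thesis by (simp add: Li2_def[abs_def])
qed

lemma bose_log_pos: "t > 0 \<Longrightarrow> bose_log t > 0"
  by (simp add: bose_log_def)

lemma bose_log_antimono: "0 < x \<Longrightarrow> x \<le> y \<Longrightarrow> bose_log y \<le> bose_log x"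
  by (simp add: bose_log_def)

lemma continuous_on_bose_log: "continuous_on {0<..} bose_log"
  unfolding bose_log_def[abs_def] by (intro continuous_intros) auto

lemma bose_log_tendsto_0: "(bose_log \<longlongrightarrow> 0) at_top"
  unfolding bose_log_def[abs_def] by real_asymp

lemma exp_bose_log: "t > 0 \<Longrightarrow> exp (bose_log t) = 1 / (1 - exp (- t))"
  by (simp add: bose_log_def exp_minus inverse_eq_divide)

lemma bose_int_0 [simp]: "bose_int 0 = 0"
  by (simp add: bose_int_def)

lemma bose_int_has_derivative:
  assumes "x > 0"
  shows "(bose_int has_real_derivative bose_log x) (at x)"
proof -
  let ?u = "1 - exp (- x)"
  have u: "0 < ?u" "?u < 1" using assms by auto
  have "((\<lambda>x. Li2 (1 - exp (- x))) has_real_derivative (- ln (1 - ?u) / ?u) * exp (- x)) (at x)"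
    by (rule DERIV_chain2[where f = Li2 and g = "\<lambda>x. 1 - exp (- x)", OF Li2_has_derivative[OF u]]) (auto intro!: derivative_eq_intros)
  moreover have "((\<lambda>x. x * bose_log x) has_real_derivative
      bose_log x + x * (- (exp (- x) / ?u))) (at x)"
    unfolding bose_log_def[abs_def] using u
    by (auto intro!: derivative_eq_intros simp: field_simps)
  ultimately have "(bose_int has_real_derivative
      (- ln (1 - ?u) / ?u) * exp (- x) + (bose_log x + x * (- (exp (- x) / ?u)))) (at x)"
    unfolding bose_int_def[abs_def] by (rule DERIV_add)
  then show ?thesis by simp
qed

lemma bose_int_increment:
  assumes "0 < x" "x \<le> y"
  shows "(y - x) * bose_log y \<le> bose_int y - bose_int x"
    and "bose_int y - bose_int x \<le> (y - x) * bose_log x"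
proof -
  have "(y - x) * bose_log y \<le> bose_int y - bose_int x \<and>
        bose_int y - bose_int x \<le> (y - x) * bose_log x"
  proof (cases "x = y")
    case False
    then obtain w where w: "x < w" "w < y" "bose_int y - bose_int x = (y - x) * bose_log w"
      using MVT2[of x y bose_int bose_log] bose_int_has_derivative assms by fastforce
    then have "bose_log y \<le> bose_log w" "bose_log w \<le> bose_log x"
      using assms by (auto intro!: bose_log_antimono)
    then show ?thesis using w assms by (auto intro!: mult_left_mono)
  qed simp
  then show "(y - x) * bose_log y \<le> bose_int y - bose_int x"
    and "bose_int y - bose_int x \<le> (y - x) * bose_log x" by auto
qed

lemma bose_int_ge: "x > 0 \<Longrightarrow> x * bose_log x \<le> bose_int x"
  using Li2_nonneg[of "1 - exp (- x)"] by (simp add: bose_int_def)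

text \<open>The left end 0, where \<^const>\<open>bose_log\<close> has a logarithmic pole, is covered here because the lower
  bound only involves the right end.\<close>

lemma bose_int_increment_ge:
  assumes "0 \<le> x" "x \<le> y" "0 < y"
  shows "(y - x) * bose_log y \<le> bose_int y - bose_int x"
  using bose_int_increment(1)[of x y] bose_int_ge[of y] assms by (cases "x = 0") auto

lemma bose_int_mono: 
  assumes "0 \<le> x" "x \<le> y"
  shows "bose_int x \<le> bose_int y"
proof (cases "y = 0")
  case False
  then have "0 \<le> (y - x) * bose_log y" 
    using assms bose_log_pos[of y] by (intro mult_nonneg_nonneg) auto
  then show ?thesis using bose_int_increment_ge[of x y] assms False by linarith
qed (use assms in auto)

lemma bose_int_tendsto_at_top: "(bose_int \<longlongrightarrow> pi\<^sup>2 / 6) at_top"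
proof -
  have "((\<lambda>x. Li2 (1 - exp (- x))) \<longlongrightarrow> Li2 1) at_top"
  proof (rule continuous_on_tendsto_compose[OF continuous_on_Li2])
    show "((\<lambda>x::real. 1 - exp (- x)) \<longlongrightarrow> 1) at_top" by real_asymp
    show "\<forall>\<^sub>F x::real in at_top. 1 - exp (- x) \<in> {0..1}"
      using eventually_ge_at_top[of 0] by eventually_elim auto
  qed auto
  moreover have "((\<lambda>x. x * bose_log x) \<longlongrightarrow> 0) at_top"
    unfolding bose_log_def by real_asymp
  ultimately have "(bose_int \<longlongrightarrow> Li2 1 + 0) at_top"
    unfolding bose_int_def[abs_def] by (rule tendsto_add)
  then show ?thesis by (simp add: Li2_1)
qed

lemma bose_int_le: 
  assumes "0 \<le> x"
  shows "bose_int x \<le> pi\<^sup>2 / 6"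
proof (rule tendsto_lowerbound[OF bose_int_tendsto_at_top])
  show "\<forall>\<^sub>F y in at_top. bose_int x \<le> bose_int y"
    using eventually_ge_at_top[of x] by eventually_elim (use assms bose_int_mono in auto)
qed simp

lemma bose_int_tendsto_at_right_0: "(bose_int \<longlongrightarrow> 0) (at_right 0)"
proof -
  have "((\<lambda>x. Li2 (1 - exp (- x))) \<longlongrightarrow> Li2 0) (at_right 0)"
  proof (rule continuous_on_tendsto_compose[OF continuous_on_Li2])
    show "((\<lambda>x::real. 1 - exp (- x)) \<longlongrightarrow> 0) (at_right 0)" by real_asymp
    show "\<forall>\<^sub>F x::real in at_right 0. 1 - exp (- x) \<in> {0..1}"
      using eventually_at_right_less[of 0] by eventually_elim auto
  qed auto
  moreover have "((\<lambda>x. x * bose_log x) \<longlongrightarrow> 0) (at_right 0)"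
    unfolding bose_log_def by real_asymp
  ultimately have "(bose_int \<longlongrightarrow> Li2 0 + 0) (at_right 0)"
    unfolding bose_int_def[abs_def] by (rule tendsto_add)
  then show ?thesis by simp
qed

section \<open>The variational problem and the limit shape\<close>

lemma T_root_pos: "q > 0 \<Longrightarrow> T_root q > 0"
  and bose_log_T_root: "q > 0 \<Longrightarrow> bose_log (T_root q) = q * T_root q"
proof -
  assume q: "q > 0"
  have *: "T_root q > 0 \<and> exp (- q * T_root q) = 1 - exp (- T_root q)"
    unfolding T_root_def by (rule theI'[OF T_root_ex1[OF q]])
  then show "T_root q > 0" by simp
  have "bose_log (T_root q) = - ln (exp (- q * T_root q))"
    unfolding bose_log_def using * by simp
  then show "bose_log (T_root q) = q * T_root q" by simp
qed

lemma theta_pos: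
  assumes "q \<ge> 0"
  shows "theta q > 0"
proof (cases "q = 0")
  case False
  then have "T_root q > 0" using T_root_pos assms by simp
  then have "q * (T_root q)\<^sup>2 / 2 + Li2 (1 - exp (- T_root q)) > 0"
    using Li2_nonneg[of "1 - exp (- T_root q)"] assms False by (intro add_pos_nonneg) auto
  then show ?thesis using False by (simp add: theta_def)
qed (simp add: theta_def)

text \<open>This is the maximal value of \<open>I x - q x\<^sup>2 / 2\<close> over \<open>x \<ge> 0\<close>, where \<open>I\<close> is \<^const>\<open>bose_int\<close>.  For
  \<open>q = 0\<close> the maximum is only approached as \<open>x \<rightarrow> \<infinity>\<close>.\<close>

lemma theta_squared:
  assumes "q \<ge> 0"
  shows "(theta q)\<^sup>2 = (if q = 0 then pi\<^sup>2 / 6 else bose_int (T_root q) - q * (T_root q)\<^sup>2 / 2)"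
proof (cases "q = 0")
  case True
  then show ?thesis by (simp add: theta_def power_divide)
next
  case False
  then have T: "T_root q > 0" "bose_log (T_root q) = q * T_root q"
    using T_root_pos bose_log_T_root assms by simp_all
  then have "q * (T_root q)\<^sup>2 / 2 + Li2 (1 - exp (- T_root q)) > 0"
    using Li2_nonneg[of "1 - exp (- T_root q)"] assms False by (intro add_pos_nonneg) auto
  then have "(theta q)\<^sup>2 = q * (T_root q)\<^sup>2 / 2 + Li2 (1 - exp (- T_root q))"
    using False by (simp add: theta_def)
  then show ?thesis
    using False T by (simp add: bose_int_def power2_eq_square field_simps)
qed

text \<open>Concavity of \<^const>\<open>bose_int\<close>: its graph lies below the tangent at \<open>T\<^sub>q\<close>, which has slope \<open>q T\<^sub>q\<close>.  The
  quadratic gain away from \<open>T\<^sub>q\<close> later absorbs error terms that grow with \<open>x\<close>.  For \<open>q = 0\<close> all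
  terms with \<^const>\<open>T_root\<close> vanish, so that one statement covers both cases.\<close>

lemma bose_int_le_theta:
  assumes "q \<ge> 0" "x \<ge> 0"
  shows "bose_int x \<le> (theta q)\<^sup>2 + q * x\<^sup>2 / 2 - q * (x - T_root q)\<^sup>2 / 2"
proof (cases "q = 0")
  case True
  then show ?thesis using bose_int_le[OF assms(2)] theta_squared[of q] by simp
next
  case False
  let ?T = "T_root q"
  have T: "?T > 0" "bose_log ?T = q * ?T"
    using T_root_pos bose_log_T_root assms False by simp_all
  have "bose_int x \<le> bose_int ?T + q * ?T * (x - ?T)"
  proof (cases "x \<le> ?T")
    case True
    then show ?thesis
      using bose_int_increment_ge[of x ?T] T assms by (simp add: algebra_simps)
  next
    case False
    then show ?thesis
      using bose_int_increment(2)[of ?T x] T assms by (simp add: algebra_simps)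
  qed
  then show ?thesis using theta_squared[of q] False assms
    by (simp add: power2_eq_square field_simps)
qed

text \<open>The function \<open>t \<mapsto> L t - q t\<close> decreases and changes sign at \<open>T\<^sub>q\<close>.\<close>

lemma limit_shape_eq_max:
  assumes "q \<ge> 0" "t > 0"
  shows "limit_shape q t = max 0 (bose_log t - q * t)"
proof (cases "q = 0")
  case True
  then show ?thesis using bose_log_pos[OF assms(2)]
    by (simp add: limit_shape_def T_end_def bose_log_def)
next
  case False
  let ?T = "T_root q"
  have T: "?T > 0" "bose_log ?T = q * ?T"
    using T_root_pos bose_log_T_root assms False by simp_all
  show ?thesis
  proof (cases "t \<le> ?T")
    case True
    then have "bose_log t \<ge> bose_log ?T" "q * t \<le> q * ?T"
      using assms by (auto intro!: bose_log_antimono mult_left_mono)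
    then show ?thesis using True T False
      by (simp add: limit_shape_def T_end_def bose_log_def)
  next
    case t: False
    then have "bose_log t \<le> bose_log ?T" "q * t \<ge> q * ?T"
      using assms T(1) by (auto intro!: bose_log_antimono mult_left_mono)
    then have "bose_log t - q * t \<le> 0" using T by linarith
    then show ?thesis using t False
      by (simp add: limit_shape_def T_end_def)
  qed
qed

lemma limit_shape_antimono:
  assumes "q \<ge> 0" "0 < s" "s \<le> t"
  shows "limit_shape q t \<le> limit_shape q s"
proof -
  have "bose_log t \<le> bose_log s" "q * s \<le> q * t"
    using assms by (auto intro!: bose_log_antimono mult_left_mono)
  then show ?thesis using assms by (simp add: limit_shape_eq_max)
qed

lemma continuous_on_limit_shape: 
  assumes "q \<ge> 0"
  shows "continuous_on {0<..} (limit_shape q)"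
proof -
  have "continuous_on {0<..} (\<lambda>t. max 0 (bose_log t - q * t))"
    by (intro continuous_intros continuous_on_bose_log)
  then show ?thesis
    by (rule continuous_on_eq) (use assms limit_shape_eq_max in auto)
qed

lemma limit_shape_tendsto_0:
  assumes "q \<ge> 0"
  shows "(limit_shape q \<longlongrightarrow> 0) at_top"
proof (rule tendsto_sandwich[OF _ _ tendsto_const bose_log_tendsto_0])
  show "\<forall>\<^sub>F t in at_top. 0 \<le> limit_shape q t"
    using eventually_gt_at_top[of 0] by eventually_elim (use assms limit_shape_eq_max in auto)
  show "\<forall>\<^sub>F t in at_top. limit_shape q t \<le> bose_log t"
    using eventually_gt_at_top[of 0]
  proof eventually_elim
    case (elim t)
    then have "q * t \<ge> 0" using assms by simp
    then show ?case using assms elim limit_shape_eq_max bose_log_pos[of t] by simp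
  qed
qed

section \<open>Partitions as free excesses over the minimal partition\<close>

definition gap_sum :: "(nat \<Rightarrow> nat) \<Rightarrow> nat \<Rightarrow> nat" where
  "gap_sum qs m = (\<Sum>l<m. qs l)"

text \<open>The weight of the smallest partition with \<open>k\<close> parts in the class, whose parts are the sums of the
  first \<open>1, \<dots>, k\<close> gaps.\<close>

definition min_weight :: "(nat \<Rightarrow> nat) \<Rightarrow> nat \<Rightarrow> nat" where
  "min_weight qs k = (\<Sum>m<k. gap_sum qs (Suc m))"

definition from_excess :: "(nat \<Rightarrow> nat) \<Rightarrow> nat \<Rightarrow> (nat \<Rightarrow> nat) \<Rightarrow> nat \<Rightarrow> nat" where
  "from_excess qs k r = (\<lambda>i. \<Sum>j\<in>{i..<k}. qs (k - Suc j) + r j)"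

text \<open>Restricted to the indices of the parts, so that for given length the excesses range over a
  set of extensional functions and \<^const>\<open>from_excess\<close> is injective there.\<close>

definition excess :: "(nat \<Rightarrow> nat) \<Rightarrow> (nat \<Rightarrow> nat) \<Rightarrow> nat \<Rightarrow> nat" where
  "excess qs p = (\<lambda>j\<in>{..<part_length p}. p j - p (Suc j) - qs (part_length p - Suc j))"

lemma gap_sum_mono: "m \<le> n \<Longrightarrow> gap_sum qs m \<le> gap_sum qs n"
  unfolding gap_sum_def by (intro sum_mono2) auto

lemma gap_sum_Suc_pos: "gap_sequence qs \<Longrightarrow> gap_sum qs (Suc m) \<ge> 1"
  using gap_sum_mono[of 1 "Suc m" qs] by (simp add: gap_sum_def gap_sequence_def)

lemma min_weight_ge: "gap_sequence qs \<Longrightarrow> k \<le> min_weight qs k"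
  unfolding min_weight_def using sum_mono[of "{..<k}" "\<lambda>_. 1" "\<lambda>m. gap_sum qs (Suc m)"] gap_sum_Suc_pos
  by simp

text \<open>The support of an antitone sequence is downward closed, hence an initial segment.\<close>

lemma partition_support:
  assumes "is_partition p"
  shows "{i. p i > 0} = {..<part_length p}"
proof -
  let ?S = "{i. p i > 0}"
  have fin: "finite ?S" and anti: "antimono p" using assms by (auto simp: is_partition_def)
  have down: "j \<in> ?S" if "i \<in> ?S" "j \<le> i" for i j
    using antimonoD[OF anti that(2)] that(1) by simp
  obtain n where n: "?S \<subseteq> {..<n}" using fin finite_nat_iff_bounded by blast
  define m where "m = (LEAST m. m \<notin> ?S)"
  have "n \<notin> ?S" using n by auto
  then have m: "m \<notin> ?S" unfolding m_def by (rule LeastI)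
  have "i \<in> ?S" if "i < m" for i using not_less_Least[of i "\<lambda>m. m \<notin> ?S"] that unfolding m_def by blast
  moreover have "i < m" if "i \<in> ?S" for i using down[OF that, of m] m by (meson not_less)
  ultimately have "?S = {..<m}" by blast
  then show ?thesis by (simp add: part_length_def)
qed

lemma part_pos_iff: "is_partition p \<Longrightarrow> p i > 0 \<longleftrightarrow> i < part_length p"
  using partition_support[of p] by blast

lemma part_weight_eq: "is_partition p \<Longrightarrow> part_weight p = (\<Sum>i<part_length p. p i)"
  unfolding part_weight_def by (simp only: partition_support)

lemma sum_from_excess_gaps:
  assumes "i \<le> k"
  shows "(\<Sum>j\<in>{i..<k}. qs (k - Suc j)) = gap_sum qs (k - i)"
proof -
  have "(\<Sum>j\<in>{i..<k}. qs (k - Suc j)) = (\<Sum>j<k - i. qs (k - Suc (i + j)))"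
    using assms by (intro sum.reindex_bij_witness[of _ "\<lambda>j. i + j" "\<lambda>j. j - i"]) auto
  also have "\<dots> = (\<Sum>j<k - i. qs (k - i - Suc j))" by (simp add: diff_diff_add)
  also have "\<dots> = gap_sum qs (k - i)"
    unfolding gap_sum_def by (rule sum.nat_diff_reindex)
  finally show ?thesis .
qed

lemma from_excess_eq:
  assumes "i \<le> k"
  shows "from_excess qs k r i = gap_sum qs (k - i) + (\<Sum>j\<in>{i..<k}. r j)"
  using sum_from_excess_gaps[OF assms, of qs] by (simp add: from_excess_def sum.distrib)

lemma from_excess_step:
  "i < k \<Longrightarrow> from_excess qs k r i = from_excess qs k r (Suc i) + qs (k - Suc i) + r i"
  by (simp add: from_excess_def sum.atLeast_Suc_lessThan)

lemma from_excess_eq_0: "k \<le> i \<Longrightarrow> from_excess qs k r i = 0"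
  by (simp add: from_excess_def)

lemma from_excess_support:
  assumes "gap_sequence qs"
  shows "{i. from_excess qs k r i > 0} = {..<k}"
proof -
  have "from_excess qs k r i > 0" if "i < k" for i
    using gap_sum_Suc_pos[OF assms, of "k - Suc i"] that
    by (simp add: from_excess_eq Suc_diff_Suc)
  moreover have "i < k" if "from_excess qs k r i > 0" for i
    using that from_excess_eq_0[of k i] by (cases "i < k") auto
  ultimately show ?thesis by auto
qed

lemma part_length_from_excess: "gap_sequence qs \<Longrightarrow> part_length (from_excess qs k r) = k"
  by (simp add: part_length_def from_excess_support)

lemma is_partition_from_excess:
  assumes "gap_sequence qs"
  shows "is_partition (from_excess qs k r)"
proof -
  have "antimono (from_excess qs k r)"
    unfolding from_excess_def by (intro antimonoI sum_mono2) auto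
  then show ?thesis by (simp add: is_partition_def from_excess_support[OF assms])
qed

lemma from_excess_in_gap_partitions:
  "gap_sequence qs \<Longrightarrow> from_excess qs k r \<in> gap_partitions qs"
  using is_partition_from_excess[of qs k r]
  by (simp add: gap_partitions_def part_length_from_excess from_excess_step)

lemma sum_triangle: "(\<Sum>i<k. \<Sum>j\<in>{i..<k}. f j) = (\<Sum>j<k. Suc j * f j)" for f :: "nat \<Rightarrow> nat"
proof (induction k)
  case (Suc k)
  have "(\<Sum>i<Suc k. \<Sum>j\<in>{i..<Suc k}. f j) = (\<Sum>i<Suc k. (\<Sum>j\<in>{i..<k}. f j) + f k)"
    by (intro sum.cong) auto
  also have "\<dots> = (\<Sum>i<k. \<Sum>j\<in>{i..<k}. f j) + Suc k * f k"
    by (simp add: sum.distrib)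
  finally show ?case using Suc by simp
qed simp

text \<open>The excess \<open>r j\<close> is added to each of the parts \<open>0, \<dots>, j\<close>, hence counts \<open>j + 1\<close> times.\<close>

lemma part_weight_from_excess:
  assumes "gap_sequence qs"
  shows "part_weight (from_excess qs k r) = min_weight qs k + (\<Sum>j<k. Suc j * r j)"
proof -
  have "part_weight (from_excess qs k r) = (\<Sum>i<k. from_excess qs k r i)"
    using part_weight_eq[OF is_partition_from_excess[OF assms]] part_length_from_excess[OF assms]
    by simp
  also have "\<dots> = (\<Sum>i<k. gap_sum qs (k - i)) + (\<Sum>i<k. \<Sum>j\<in>{i..<k}. r j)"
    by (simp add: from_excess_eq sum.distrib)
  also have "(\<Sum>i<k. gap_sum qs (k - i)) = (\<Sum>i<k. gap_sum qs (Suc (k - Suc i)))"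
    by (intro sum.cong) (auto simp: Suc_diff_Suc)
  also have "\<dots> = min_weight qs k"
    unfolding min_weight_def by (rule sum.nat_diff_reindex)
  finally show ?thesis by (simp only: sum_triangle)
qed

lemma from_excess_excess:
  assumes "p \<in> gap_partitions qs"
  shows "from_excess qs (part_length p) (excess qs p) = p"
proof
  let ?k = "part_length p"
  have part: "is_partition p" using assms by (simp add: gap_partitions_def)
  have step: "p j = p (Suc j) + qs (?k - Suc j) + excess qs p j" if "j < ?k" for j
    using assms that by (simp add: gap_partitions_def excess_def)
  fix i
  show "from_excess qs ?k (excess qs p) i = p i"
  proof (cases "i \<le> ?k")
    case True
    then show ?thesis
    proof (induction rule: inc_induct)
      case base
      then show ?case using part_pos_iff[OF part, of ?k] by (simp add: from_excess_eq_0)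
    next
      case (step j)
      then show ?case using from_excess_step[of j ?k qs] \<open>\<And>j. j < ?k \<Longrightarrow> _\<close>[of j] by simp
    qed
  next
    case False
    then show ?thesis using part_pos_iff[OF part, of i] by (simp add: from_excess_eq_0)
  qed
qed

lemma excess_from_excess:
  assumes "gap_sequence qs"
  shows "excess qs (from_excess qs k r) = restrict r {..<k}"
  by (auto simp: excess_def part_length_from_excess[OF assms] from_excess_step restrict_def)

lemma inj_on_excess:
  "inj_on (excess qs) {p \<in> gap_partitions qs. part_length p = k}"
  by (rule inj_on_inverseI[where g = "from_excess qs k"]) (use from_excess_excess in auto)

lemma inj_on_from_excess:
  assumes "gap_sequence qs"
  shows "inj_on (from_excess qs k) (PiE {..<k} B)"
  by (rule inj_on_inverseI[where g = "excess qs"])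
     (simp add: excess_from_excess[OF assms] PiE_restrict)

lemma part_weight_excess:
  assumes "gap_sequence qs" "p \<in> gap_partitions qs"
  shows "part_weight p = min_weight qs (part_length p) + (\<Sum>j<part_length p. Suc j * excess qs p j)"
  using part_weight_from_excess[OF assms(1), of "part_length p" "excess qs p"]
    from_excess_excess[OF assms(2)] by simp

lemma part_excess:
  assumes "p \<in> gap_partitions qs" "i \<le> part_length p"
  shows "p i = gap_sum qs (part_length p - i) + (\<Sum>j\<in>{i..<part_length p}. excess qs p j)"
  using from_excess_eq[OF assms(2), of qs "excess qs p"] from_excess_excess[OF assms(1)] by simp

text \<open>Increasing the largest part by 1 keeps all gap conditions and is injective.  The weight 0 is
  excluded since the empty partition has no part to increase.\<close>

lemma card_gap_partitions_of_mono:
  assumes "gap_sequence qs" "1 \<le> m" "m \<le> n"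
  shows "card (gap_partitions_of qs m) \<le> card (gap_partitions_of qs n)"
  using assms(3,2)
proof (induction rule: dec_induct)
  case (step n)
  define grow where "grow = (\<lambda>p::nat \<Rightarrow> nat. p(0 := Suc (p 0)))"
  have "grow p \<in> gap_partitions_of qs (Suc n)" if p: "p \<in> gap_partitions_of qs n" for p
  proof -
    have part: "is_partition p" and w: "part_weight p = n" and gap: "p \<in> gap_partitions qs"
      using p by (auto simp: gap_partitions_of_def gap_partitions_def)
    have "part_length p > 0"
      using part_weight_eq[OF part] w step by (intro Nat.gr0I) auto
    then have supp: "{i. grow p i > 0} = {i. p i > 0}"
      using part_pos_iff[OF part] by (auto simp: grow_def)
    have "antimono (grow p)"
    proof (rule antimonoI)
      fix x y :: nat assume "x \<le> y"
      then show "grow p y \<le> grow p x"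
        using part antimonoD[of p x y] by (auto simp: grow_def is_partition_def)
    qed
    then have part': "is_partition (grow p)"
      using part by (simp add: is_partition_def supp)
    have len: "part_length (grow p) = part_length p" by (simp add: part_length_def supp)
    have "(\<Sum>i<part_length p. grow p i) = Suc (\<Sum>i<part_length p. p i)"
      using \<open>part_length p > 0\<close> by (simp add: grow_def lessThan_nat_numeral sum.remove[of _ "0::nat"])
    then have "part_weight (grow p) = Suc n"
      using part_weight_eq[OF part'] part_weight_eq[OF part] w len by simp
    moreover have "grow p j \<ge> grow p (Suc j) + qs (part_length p - Suc j)" if "j < part_length p" for j
      using gap that by (auto simp: gap_partitions_def grow_def le_Suc_eq)
    ultimately show ?thesis using part' len by (simp add: gap_partitions_of_def gap_partitions_def)
  qed
  moreover have "inj_on grow (gap_partitions_of qs n)"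
    by (rule inj_on_inverseI[where g = "\<lambda>p. p(0 := p 0 - 1)"]) (auto simp: grow_def)
  ultimately have "card (gap_partitions_of qs n) \<le> card (gap_partitions_of qs (Suc n))"
    by (intro card_inj_on_le[where f = grow]) (auto simp: finite_gap_partitions_of)
  then show ?case using step by simp
qed simp

section \<open>Exponential sums over partitions of fixed length\<close>

text \<open>The Boltzmann weight \<open>exp (- z N)\<close>, tilted by the size of the part with index \<open>i\<close>.\<close>

definition tilted_weight :: "real \<Rightarrow> real \<Rightarrow> nat \<Rightarrow> (nat \<Rightarrow> nat) \<Rightarrow> real" where
  "tilted_weight z a i p = exp (a * real (p i) - z * real (part_weight p))"

text \<open>One unit of the excess at \<open>j\<close> adds \<open>j + 1\<close> to the weight, and adds 1 to the part with
  index \<open>i\<close> if \<open>i \<le> j\<close>.\<close>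

definition rate :: "real \<Rightarrow> real \<Rightarrow> nat \<Rightarrow> nat \<Rightarrow> real" where
  "rate z a i j = z * real (Suc j) - (if i \<le> j then a else 0)"

text \<open>For fixed length the tilted weight is a product over the excesses.  The case \<open>i = part_length p\<close>,
  in which the part is 0, is harmless and is needed for the empty partition.\<close>

lemma tilted_weight_eq:
  assumes "gap_sequence qs" "p \<in> gap_partitions qs" "i \<le> part_length p"
  shows "tilted_weight z a i p =
    exp (a * real (gap_sum qs (part_length p - i)) - z * real (min_weight qs (part_length p))) *
    (\<Prod>j<part_length p. exp (- rate z a i j) ^ excess qs p j)"
proof -
  let ?k = "part_length p"
  let ?e = "\<lambda>j. real (excess qs p j)"
  have "(\<Sum>j\<in>{i..<?k}. ?e j) = (\<Sum>j<?k. if i \<le> j then ?e j else 0)"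
  proof -
    have "{..<?k} \<inter> {j. i \<le> j} = {i..<?k}" by auto
    then show ?thesis by (simp add: sum.If_cases)
  qed
  then have "a * real (p i) - z * real (part_weight p) =
      (a * real (gap_sum qs (?k - i)) - z * real (min_weight qs ?k)) +
      (a * (\<Sum>j<?k. if i \<le> j then ?e j else 0) - z * (\<Sum>j<?k. real (Suc j) * ?e j))"
    using part_weight_excess[OF assms(1,2)] part_excess[OF assms(2,3)]
    by (simp add: algebra_simps)
  also have "a * (\<Sum>j<?k. if i \<le> j then ?e j else 0) - z * (\<Sum>j<?k. real (Suc j) * ?e j)
      = (\<Sum>j<?k. ?e j * (- rate z a i j))"
    unfolding sum_distrib_left sum_subtractf[symmetric]
    by (intro sum.cong refl) (simp add: rate_def algebra_simps)
  finally show ?thesis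
    by (simp only: tilted_weight_def exp_add exp_sum[OF finite_lessThan] exp_of_nat_mult)
qed

lemma sum_geometric_le:
  fixes w :: real
  assumes "0 \<le> w" "w < 1"
  shows "(\<Sum>r<R. w ^ r) \<le> 1 / (1 - w)"
  using sum_le_suminf[of "\<lambda>r. w ^ r" "{..<R}"] assms by (simp add: suminf_geometric)

text \<open>By the product form the sum is at most a product of geometric series.  Working with finite sets
  of partitions avoids summability questions; the bound does not depend on the set.\<close>

lemma sum_tilted_weight_le:
  assumes gap: "gap_sequence qs" and fin: "finite X"
    and X: "X \<subseteq> {p \<in> gap_partitions qs. part_length p = k}" and i: "i \<le> k"
    and rate: "\<And>j. j < k \<Longrightarrow> rate z a i j > 0"
  shows "(\<Sum>p\<in>X. tilted_weight z a i p) \<le>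
    exp (a * real (gap_sum qs (k - i)) - z * real (min_weight qs k) + (\<Sum>j<k. bose_log (rate z a i j)))"
proof -
  let ?c = "exp (a * real (gap_sum qs (k - i)) - z * real (min_weight qs k))"
  let ?w = "\<lambda>j. exp (- rate z a i j)"
  define R where "R = Suc (Max (\<Union>p\<in>X. excess qs p ` {..<k}))"
  have "excess qs p \<in> PiE {..<k} (\<lambda>_. {..<R})" if "p \<in> X" for p
  proof -
    have "excess qs p j < R" if "j < k" for j
      unfolding R_def less_Suc_eq_le using fin \<open>p \<in> X\<close> that by (intro Max_ge) auto
    moreover have "part_length p = k" using X that by auto
    ultimately show ?thesis by (auto simp: excess_def PiE_def)
  qed
  then have sub: "excess qs ` X \<subseteq> PiE {..<k} (\<lambda>_. {..<R})" by auto
  have inj: "inj_on (excess qs) X" using inj_on_excess X by (rule inj_on_subset)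
  have "(\<Sum>p\<in>X. tilted_weight z a i p) = (\<Sum>p\<in>X. ?c * (\<Prod>j<k. ?w j ^ excess qs p j))"
    using X i by (intro sum.cong refl) (auto simp: tilted_weight_eq[OF gap])
  also have "\<dots> = ?c * (\<Sum>r\<in>excess qs ` X. \<Prod>j<k. ?w j ^ r j)"
    by (simp add: sum.reindex[OF inj] sum_distrib_left)
  also have "\<dots> \<le> ?c * (\<Sum>r\<in>PiE {..<k} (\<lambda>_. {..<R}). \<Prod>j<k. ?w j ^ r j)"
    using sub by (intro mult_left_mono sum_mono2 finite_PiE prod_nonneg) auto
  also have "\<dots> = ?c * (\<Prod>j<k. \<Sum>r<R. ?w j ^ r)"
    by (subst prod_sum_PiE) auto
  also have "\<dots> \<le> ?c * (\<Prod>j<k. exp (bose_log (rate z a i j)))"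
  proof (intro mult_left_mono prod_mono conjI)
    fix j assume "j \<in> {..<k}"
    then have "rate z a i j > 0" using rate by simp
    then show "(\<Sum>r<R. ?w j ^ r) \<le> exp (bose_log (rate z a i j))"
      using sum_geometric_le[of "?w j" R] by (simp add: exp_bose_log)
  qed (auto intro!: sum_nonneg)
  finally show ?thesis by (simp add: exp_add exp_sum)
qed

text \<open>The product of truncated geometric series converges to the full product, so that some truncation
  reaches one half of it.\<close>

lemma finite_subset_sum_weight_ge:
  assumes gap: "gap_sequence qs" and z: "z > 0"
  obtains X where "finite X" "X \<subseteq> gap_partitions qs"
    "(\<Sum>p\<in>X. tilted_weight z 0 0 p) \<ge>
      exp ((\<Sum>j<k. bose_log (z * real (Suc j))) - z * real (min_weight qs k)) / 2"
proof -
  let ?c = "exp (- z * real (min_weight qs k))"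
  let ?w = "\<lambda>j::nat. exp (- (z * real (Suc j)))"
  let ?P = "\<Prod>j<k. 1 / (1 - ?w j)"
  have w: "norm (?w j) < 1" for j using z by simp
  have "(\<lambda>R. \<Prod>j<k. \<Sum>r<R. ?w j ^ r) \<longlonglongrightarrow> ?P"
    by (intro tendsto_prod geometric_sums[OF w, unfolded sums_def])
  moreover have P: "?P > 0" using z by (intro prod_pos) simp
  ultimately have "\<forall>\<^sub>F R in sequentially. (\<Prod>j<k. \<Sum>r<R. ?w j ^ r) > ?P / 2"
    by (intro order_tendstoD) auto
  then obtain R where R: "(\<Prod>j<k. \<Sum>r<R. ?w j ^ r) > ?P / 2"
    by (auto dest: eventually_happens)
  define B where "B = PiE {..<k} (\<lambda>_. {..<R})"
  define X where "X = from_excess qs k ` B"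
  have "(\<Sum>p\<in>X. tilted_weight z 0 0 p) = (\<Sum>r\<in>B. tilted_weight z 0 0 (from_excess qs k r))"
    unfolding X_def B_def by (subst sum.reindex[OF inj_on_from_excess[OF gap]]) simp
  also have "\<dots> = (\<Sum>r\<in>B. ?c * (\<Prod>j<k. ?w j ^ r j))"
  proof (intro sum.cong refl)
    fix r
    have "tilted_weight z 0 0 (from_excess qs k r) =
        exp (- z * real (min_weight qs k) + (\<Sum>j<k. real (r j) * (- (z * real (Suc j)))))"
      unfolding tilted_weight_def part_weight_from_excess[OF gap]
      by (simp add: sum_distrib_left sum_negf distrib_left mult_ac del: of_nat_Suc mult_Suc mult_Suc_right)
    then show "tilted_weight z 0 0 (from_excess qs k r) = ?c * (\<Prod>j<k. ?w j ^ r j)"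
      by (simp only: exp_add exp_sum[OF finite_lessThan] exp_of_nat_mult)
  qed
  also have "\<dots> = ?c * (\<Prod>j<k. \<Sum>r<R. ?w j ^ r)"
    unfolding B_def by (subst prod_sum_PiE) (auto simp: sum_distrib_left)
  also have "\<dots> \<ge> ?c * (?P / 2)" using R by (intro mult_left_mono) auto
  also have "?P = (\<Prod>j<k. exp (bose_log (z * real (Suc j))))"
    using z by (intro prod.cong refl) (simp add: exp_bose_log del: of_nat_Suc)
  also have "?c * (\<dots> / 2) = exp ((\<Sum>j<k. bose_log (z * real (Suc j))) - z * real (min_weight qs k)) / 2"
    by (simp add: exp_diff exp_sum exp_minus field_simps del: of_nat_Suc)
  finally have "(\<Sum>p\<in>X. tilted_weight z 0 0 p) \<ge>
      exp ((\<Sum>j<k. bose_log (z * real (Suc j))) - z * real (min_weight qs k)) / 2" .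
  moreover have "finite X" unfolding X_def B_def by (intro finite_imageI finite_PiE) auto
  moreover have "X \<subseteq> gap_partitions qs"
    unfolding X_def using from_excess_in_gap_partitions[OF gap] by auto
  ultimately show ?thesis using that by blast
qed

text \<open>Comparison of the sum of a decreasing function with its integral, cell by cell.\<close>

lemma sum_bose_log_le:
  assumes "z > 0" "i \<le> k" "a \<le> z * real i"
  shows "z * (\<Sum>j\<in>{i..<k}. bose_log (z * real (Suc j) - a)) \<le> bose_int (z * real k - a) - bose_int (z * real i - a)"
  using assms(2)
proof (induction rule: dec_induct)
  case (step k)
  have *: "a \<le> z * real k" using step assms by (simp add: order_trans[OF assms(3)])
  have diff: "z * real (Suc k) - a - (z * real k - a) = z" by (simp add: algebra_simps)
  have "z * bose_log (z * real (Suc k) - a) \<le> bose_int (z * real (Suc k) - a) - bose_int (z * real k - a)"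
    using bose_int_increment_ge[of "z * real k - a" "z * real (Suc k) - a", unfolded diff] assms * diff
    by linarith
  then show ?case using step by (simp add: distrib_left del: of_nat_Suc)
qed simp

lemma sum_bose_log_rate_le:
  assumes z: "z > 0" and "i \<le> k" "a \<le> z * real i"
  shows "z * (\<Sum>j<k. bose_log (rate z a i j)) \<le>
    bose_int (z * real i) + bose_int (z * real k - a) - bose_int (z * real i - a)"
proof -
  have split: "{..<k} = {0..<i} \<union> {i..<k}" using assms by auto
  have "(\<Sum>j<k. bose_log (rate z a i j)) =
      (\<Sum>j\<in>{0..<i}. bose_log (z * real (Suc j) - 0)) + (\<Sum>j\<in>{i..<k}. bose_log (z * real (Suc j) - a))"
    unfolding split by (subst sum.union_disjoint) (auto simp: rate_def)
  then show ?thesis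
    using sum_bose_log_le[OF z, of 0 i 0] sum_bose_log_le[OF assms] by (simp add: distrib_left)
qed

lemma sum_bose_log_ge:
  assumes "z > 0"
  shows "bose_int (z * real (Suc k)) - bose_int z \<le> z * (\<Sum>j<k. bose_log (z * real (Suc j)))"
proof (induction k)
  case (Suc k)
  have diff: "z * real (Suc (Suc k)) - z * real (Suc k) = z" by (simp add: algebra_simps)
  have "0 < z * real (Suc k)" using assms by simp
  then have "bose_int (z * real (Suc (Suc k))) - bose_int (z * real (Suc k)) \<le> z * bose_log (z * real (Suc k))"
    using bose_int_increment(2)[of "z * real (Suc k)" "z * real (Suc (Suc k))", unfolded diff] assms diff
    by linarith
  then show ?case using Suc by (simp add: distrib_left del: of_nat_Suc)
qed simp

section \<open>Gap sums of linear growth\<close>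

text \<open>This is \<open>Q\<^sub>k = q k + o(k)\<close>, in a form that is uniform in \<open>k\<close> and can therefore be summed.  It is all
  that the exponential scale sees of the hypothesis on the gaps.\<close>

definition linear_growth :: "(nat \<Rightarrow> nat) \<Rightarrow> real \<Rightarrow> bool" where
  "linear_growth qs q \<longleftrightarrow>
     (\<forall>\<eta>>0. \<exists>C\<ge>0. \<forall>k. \<bar>real (gap_sum qs k) - q * real k\<bar> \<le> \<eta> * real k + C)"

lemma linear_growthI:
  assumes "(\<lambda>k. real (\<Sum>i<k. qs i) - q * real k) \<in> O(\<lambda>k. real k powr \<beta>)" and "\<beta> < 1"
  shows "linear_growth qs q"
  unfolding linear_growth_def
proof (intro allI impI)
  let ?f = "\<lambda>k. real (gap_sum qs k) - q * real k"
  fix \<eta> :: real assume "\<eta> > 0"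
  have "(\<lambda>k. real k powr \<beta>) \<in> o(\<lambda>k. real k)" using \<open>\<beta> < 1\<close> by real_asymp
  then have "?f \<in> o(\<lambda>k. real k)"
    using assms(1) landau_o.big_small_trans unfolding gap_sum_def by blast
  then have "\<forall>\<^sub>F k in sequentially. norm (?f k) \<le> \<eta> * norm (real k)"
    using \<open>\<eta> > 0\<close> by (rule landau_o.smallD)
  then obtain N where N: "\<And>k. k \<ge> N \<Longrightarrow> norm (?f k) \<le> \<eta> * norm (real k)"
    by (auto simp: eventually_sequentially)
  let ?C = "\<Sum>k<N. \<bar>?f k\<bar>"
  have C: "?C \<ge> 0" by (intro sum_nonneg) auto
  have "\<bar>?f k\<bar> \<le> \<eta> * real k + ?C" for k
  proof (cases "k < N")
    case True
    then have "\<bar>?f k\<bar> \<le> ?C" by (intro member_le_sum) auto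
    then show ?thesis using \<open>\<eta> > 0\<close> by (simp add: add_increasing)
  next
    case False
    then have "\<bar>?f k\<bar> \<le> \<eta> * real k" using N[of k] by simp
    then show ?thesis using C by linarith
  qed
  then show "\<exists>C\<ge>0. \<forall>k. \<bar>?f k\<bar> \<le> \<eta> * real k + C" using C by blast
qed

lemma min_weight_estimate:
  assumes "\<And>k. \<bar>real (gap_sum qs k) - q * real k\<bar> \<le> \<eta> * real k + C"
  shows "\<bar>real (min_weight qs k) - q * real k * (real k + 1) / 2\<bar>
    \<le> \<eta> * real k * (real k + 1) / 2 + C * real k"
proof (induction k)
  case (Suc k)
  have "real (min_weight qs (Suc k)) - q * real (Suc k) * (real (Suc k) + 1) / 2 =
    (real (min_weight qs k) - q * real k * (real k + 1) / 2) +
    (real (gap_sum qs (Suc k)) - q * real (Suc k))"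
    by (simp add: min_weight_def field_simps)
  moreover have "\<eta> * real (Suc k) * (real (Suc k) + 1) / 2 + C * real (Suc k) =
    (\<eta> * real k * (real k + 1) / 2 + C * real k) + (\<eta> * real (Suc k) + C)"
    by (simp add: field_simps)
  ultimately show ?case using Suc assms[of "Suc k"] by linarith
qed (simp add: min_weight_def)

text \<open>If \<open>i < k\<close>, the largest \<open>i + 1\<close> summands of the minimal weight are each at least the gap sum on the
  left; if \<open>i = k\<close>, that gap sum is empty.\<close>

lemma min_weight_ge_mult:
  assumes "i \<le> k"
  shows "Suc i * gap_sum qs (k - i) \<le> min_weight qs k"
proof (cases "i = k")
  case False
  then have "i < k" using assms by simp
  have "Suc i * gap_sum qs (k - i) = (\<Sum>m\<in>{k - Suc i..<k}. gap_sum qs (k - i))"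
    using \<open>i < k\<close> by simp
  also have "\<dots> \<le> (\<Sum>m\<in>{k - Suc i..<k}. gap_sum qs (Suc m))"
    by (intro sum_mono gap_sum_mono) auto
  also have "\<dots> \<le> min_weight qs k"
    unfolding min_weight_def by (intro sum_mono2) auto
  finally show ?thesis .
qed (simp add: gap_sum_def)

lemma floor_div_bounds:
  assumes "z > 0" "s > 0"
  shows "z * real (nat \<lfloor>s / z\<rfloor>) \<le> s" "s < z * real (Suc (nat \<lfloor>s / z\<rfloor>))"
proof -
  have "0 \<le> s / z" using assms by simp
  then have le: "real (nat \<lfloor>s / z\<rfloor>) \<le> s / z"
    and less: "s / z < real (Suc (nat \<lfloor>s / z\<rfloor>))" by linarith+
  have "z * real (nat \<lfloor>s / z\<rfloor>) \<le> z * (s / z)"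
    using mult_left_mono[OF le, of z] assms by linarith
  moreover have "z * (s / z) < z * real (Suc (nat \<lfloor>s / z\<rfloor>))"
    by (rule mult_strict_left_mono[OF less assms(1)])
  moreover have "z * (s / z) = s" using assms by simp
  ultimately show "z * real (nat \<lfloor>s / z\<rfloor>) \<le> s" "s < z * real (Suc (nat \<lfloor>s / z\<rfloor>))"
    by linarith+
qed

text \<open>The contribution of the gaps to the exponent, for length \<open>k = x / z\<close> and with the part at \<open>s / z\<close>
  tilted by \<open>a\<close>.  The last term keeps the sum over all lengths convergent at a cost of lower order.

  For \<open>q > 0\<close> all errors from linear growth are at most a small multiple of \<open>1 + x\<^sup>2\<close>.  For \<open>q = 0\<close> there is
  no quadratic term to absorb such errors, and an unbounded range of \<open>x\<close> matters; there the term
  \<open>a Q\<close> is bounded by half of \<open>z S\<close>, using that more than \<open>s / z\<close> of the minimal parts are at least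
  \<open>Q\<close> and that \<open>a \<le> s / 2\<close>.\<close>

lemma gap_exponent_le:
  assumes gap: "gap_sequence qs" and growth: "linear_growth qs q" and q: "q \<ge> 0"
    and s: "s > 0" and a: "a \<le> s / 2" and \<eta>: "\<eta> > 0"
  shows "\<forall>\<^sub>F z in at_right 0. \<forall>i k. i \<le> k \<longrightarrow> a = 0 \<or> i = nat \<lfloor>s / z\<rfloor> \<longrightarrow>
    z * (a * real (gap_sum qs (k - i)) - z * real (min_weight qs k)) \<le>
    - (q * (z * real k)\<^sup>2 / 2) + a * q * (z * real k - s)
    + \<eta> * (1 + q * (z * real k)\<^sup>2) - z * (z * real k) / 4"
proof (cases "q = 0")
  case True
  have "z * (a * real (gap_sum qs (k - i)) - z * real (min_weight qs k)) \<le> \<eta> - z * (z * real k) / 4"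
    if "z > 0" "i \<le> k" "a = 0 \<or> i = nat \<lfloor>s / z\<rfloor>" for z i k
  proof -
    let ?Q = "real (gap_sum qs (k - i))" and ?S = "real (min_weight qs k)"
    have "a * ?Q \<le> z * ?S / 2"
    proof (cases "a \<le> 0")
      case True
      then have "a * ?Q \<le> 0" by (simp add: mult_nonpos_nonneg)
      moreover have "0 \<le> z * ?S / 2" using that by simp
      ultimately show ?thesis by linarith
    next
      case False
      then have "a \<le> z * real (Suc i) / 2"
        using that floor_div_bounds(2)[OF \<open>z > 0\<close> s] a by auto
      then have "a * ?Q \<le> z * real (Suc i) / 2 * ?Q" by (rule mult_right_mono) simp
      also have "\<dots> = z * real (Suc i * gap_sum qs (k - i)) / 2"
        by (simp del: of_nat_Suc mult_Suc)
      also have "\<dots> \<le> z * ?S / 2"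
        using min_weight_ge_mult[OF \<open>i \<le> k\<close>, of qs] \<open>z > 0\<close>
        by (intro divide_right_mono mult_left_mono of_nat_mono) auto
      finally show ?thesis .
    qed
    moreover have "z * real k \<le> z * ?S"
      using min_weight_ge[OF gap, of k] \<open>z > 0\<close> by (intro mult_left_mono) auto
    ultimately have "a * ?Q - z * ?S \<le> - (z * real k) / 2" by linarith
    then have "z * (a * ?Q - z * ?S) \<le> z * (- (z * real k) / 2)"
      using \<open>z > 0\<close> by (intro mult_left_mono) auto
    moreover have "z * (z * real k) \<ge> 0" using \<open>z > 0\<close> by simp
    ultimately show ?thesis using \<eta> by (simp add: algebra_simps)
  qed
  then show ?thesis using True eventually_at_right_less[of "0::real"]
    by (auto elim!: eventually_mono)
next
  case False
  then have q: "q > 0" using q by simp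
  \<comment> \<open>With this choice \<open>e (1 + x\<^sup>2)\<close> is at most \<open>\<eta> (1 + q x\<^sup>2)\<close>.\<close>
  define e where "e = \<eta> * min 1 q"
  have e: "e > 0" "e \<le> \<eta>" "e \<le> \<eta> * q"
    using \<eta> q by (auto simp: e_def min_def)
  \<comment> \<open>Half of the allowance \<open>e\<close> pays for the slope error in the gap sums, the other half for the terms with a factor \<open>z\<close>.\<close>
  define \<eta>' where "\<eta>' = e / (2 * (1 + \<bar>a\<bar>))"
  have \<eta>': "\<eta>' > 0" using e by (simp add: \<eta>'_def)
  have \<eta>'2: "\<eta>' * (1 + \<bar>a\<bar>) = e / 2" 
    unfolding \<eta>'_def by (simp add: divide_simps)
  obtain C where C: "C \<ge> 0" "\<And>k. \<bar>real (gap_sum qs k) - q * real k\<bar> \<le> \<eta>' * real k + C"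
    using growth \<eta>' unfolding linear_growth_def by blast
  define D where "D = C + \<bar>a\<bar> * (q + C) + 1/4"
  have D: "D > 0" using C q by (simp add: D_def add_nonneg_pos)
  have "\<forall>\<^sub>F z in at_right 0. z \<in> {0<..<min 1 (e / (2 * D))}"
    using e D by (intro eventually_at_right_real) auto
  then show ?thesis
  proof eventually_elim
    case (elim z)
    then have z: "z > 0" "z \<le> 1" "z \<le> e / (2 * D)" by auto
    then have zD: "z * D \<le> e / 2" using D by (simp add: field_simps)
    show ?case
    proof (intro allI impI)
      fix i k :: nat assume ik: "i \<le> k" "a = 0 \<or> i = nat \<lfloor>s / z\<rfloor>"
      let ?Q = "real (gap_sum qs (k - i))" and ?S = "real (min_weight qs k)"
      define x where "x = z * real k"
      have x: "x \<ge> 0" using z by (simp add: x_def)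
      have zk: "z * real (k - i) = x - z * real i" using ik by (simp add: x_def algebra_simps of_nat_diff)
      have aQ: "a * (z * ?Q) \<le> a * (q * (x - s)) + \<bar>a\<bar> * (q * z + \<eta>' * x + C * z)"
      proof (cases "a = 0")
        case False
        then have i: "z * real i \<le> s" "s < z * real i + z"
          using floor_div_bounds[OF z(1) s] ik by (auto simp: algebra_simps)
        have "z * ?Q - q * (z * real (k - i)) = z * (?Q - q * real (k - i))"
          by (simp only: algebra_simps)
        then have "\<bar>z * ?Q - q * (z * real (k - i))\<bar> = z * \<bar>?Q - q * real (k - i)\<bar>"
          using z by (simp only: abs_mult) simp
        also have "\<dots> \<le> z * (\<eta>' * real (k - i) + C)" using C z by (intro mult_left_mono) auto
        also have "\<dots> = \<eta>' * (z * real (k - i)) + C * z" by (simp only: algebra_simps)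
        also have "\<dots> = \<eta>' * (x - z * real i) + C * z" by (simp only: zk)
        also have "\<dots> \<le> \<eta>' * x + C * z" using \<eta>' z by simp
        finally have "\<bar>z * ?Q - q * (x - z * real i)\<bar> \<le> \<eta>' * x + C * z" using zk by simp
        moreover have "\<bar>q * (x - z * real i) - q * (x - s)\<bar> \<le> q * z"
        proof -
          have "\<bar>q * (x - z * real i) - q * (x - s)\<bar> = q * \<bar>s - z * real i\<bar>"
            using q by (simp add: abs_mult flip: right_diff_distrib)
          also have "\<dots> \<le> q * z" using i q by (intro mult_left_mono) auto
          finally show ?thesis .
        qed
        ultimately have "\<bar>z * ?Q - q * (x - s)\<bar> \<le> q * z + \<eta>' * x + C * z" by linarith
        then have "\<bar>a\<bar> * \<bar>z * ?Q - q * (x - s)\<bar> \<le> \<bar>a\<bar> * (q * z + \<eta>' * x + C * z)"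
          by (intro mult_left_mono) auto
        then have "\<bar>a * (z * ?Q - q * (x - s))\<bar> \<le> \<bar>a\<bar> * (q * z + \<eta>' * x + C * z)"
          by (simp only: abs_mult)
        then show ?thesis by (simp add: right_diff_distrib)
      qed simp
      have "?S \<ge> q * real k * (real k + 1) / 2 - (\<eta>' * real k * (real k + 1) / 2 + C * real k)"
        using min_weight_estimate[OF C(2), of k] by linarith
      then have "z * (z * ?S) \<ge>
          z * (z * (q * real k * (real k + 1) / 2 - (\<eta>' * real k * (real k + 1) / 2 + C * real k)))"
        using z by (intro mult_left_mono) auto
      also have "z * (z * (q * real k * (real k + 1) / 2 - (\<eta>' * real k * (real k + 1) / 2 + C * real k)))
          = q * x\<^sup>2 / 2 + q * x * z / 2 - \<eta>' * ((x\<^sup>2 + x * z) / 2) - C * z * x"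
        unfolding x_def by (simp add: field_simps power2_eq_square)
      finally have zS: "z * (z * ?S) \<ge> q * x\<^sup>2 / 2 + q * x * z / 2 - \<eta>' * ((x\<^sup>2 + x * z) / 2) - C * z * x" .
      have y: "x \<le> 1 + x\<^sup>2" using x sum_power2_ge_zero[of "x - 1" 0] 
        by (simp add: power2_eq_square algebra_simps)
      let ?y = "1 + x\<^sup>2"
      have "x * z \<le> x" using x z by (simp add: mult_left_le)
      then have "(x\<^sup>2 + x * z) / 2 \<le> ?y" using y by simp
      then have "\<eta>' * ((x\<^sup>2 + x * z) / 2) \<le> \<eta>' * ?y" using \<eta>' by (intro mult_left_mono) auto
      moreover have "C * z * x \<le> C * z * ?y" using C z y by (intro mult_left_mono) auto
      moreover have "z * x / 4 \<le> z * ?y / 4" using z y by (intro divide_right_mono mult_left_mono) auto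
      moreover have "\<bar>a\<bar> * (q * z + \<eta>' * x + C * z) \<le> \<bar>a\<bar> * (q * z * ?y + \<eta>' * ?y + C * z * ?y)"
      proof (intro mult_left_mono add_mono)
        show "q * z \<le> q * z * ?y" "C * z \<le> C * z * ?y"
          using q z C by (auto simp: distrib_left)
      qed (use y \<eta>' in auto)
      moreover have "0 \<le> q * x * z / 2" using q x z by simp
      moreover have "z * (a * ?Q - z * ?S) = a * (z * ?Q) - z * (z * ?S)" by (simp only: algebra_simps)
      moreover have "a * (q * (x - s)) = a * q * (x - s)" by (simp only: mult.assoc)
      ultimately have "z * (a * ?Q - z * ?S) \<le> - (q * x\<^sup>2 / 2) + a * q * (x - s) - z * x / 4 +
          (\<eta>' * ?y + C * z * ?y + z * ?y / 4 + \<bar>a\<bar> * (q * z * ?y + \<eta>' * ?y + C * z * ?y))"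
        using aQ zS by linarith
      also have "\<eta>' * ?y + C * z * ?y + z * ?y / 4 + \<bar>a\<bar> * (q * z * ?y + \<eta>' * ?y + C * z * ?y)
          = (\<eta>' * (1 + \<bar>a\<bar>) + z * D) * ?y"
        by (simp add: D_def algebra_simps)
      also have "\<dots> \<le> (e / 2 + e / 2) * ?y"
        using zD \<eta>'2 by (intro mult_right_mono) auto
      also have "\<dots> = e + e * x\<^sup>2" by (simp add: algebra_simps)
      also have "\<dots> \<le> \<eta> + \<eta> * q * x\<^sup>2" using e by (intro add_mono mult_right_mono) auto
      finally show "z * (a * ?Q - z * ?S) \<le>
        - (q * (z * real k)\<^sup>2 / 2) + a * q * (z * real k - s)
        + \<eta> * (1 + q * (z * real k)\<^sup>2) - z * (z * real k) / 4"
        unfolding x_def[symmetric] by (simp add: algebra_simps)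
    qed
  qed
qed

text \<open>Summation over the length by a geometric series.\<close>

lemma sum_by_length_le:
  assumes fin: "finite X" and z: "z > 0" and B: "B \<ge> 0"
    and le: "\<And>k. k \<in> part_length ` X \<Longrightarrow>
      (\<Sum>p\<in>{p \<in> X. part_length p = k}. f p) \<le> B * exp (- z * real k)"
  shows "(\<Sum>p\<in>X. f p) \<le> B / (1 - exp (- z))"
proof -
  let ?K = "part_length ` X"
  have "(\<Sum>p\<in>X. f p) = (\<Sum>k\<in>?K. \<Sum>p\<in>{p \<in> X. part_length p = k}. f p)"
    using fin by (intro sum.group[symmetric]) auto
  also have "\<dots> \<le> (\<Sum>k\<in>?K. B * exp (- z) ^ k)"
    using le by (intro sum_mono) (simp add: exp_of_nat_mult[symmetric] mult.commute)
  also have "\<dots> \<le> (\<Sum>k<Suc (Max ?K). B * exp (- z) ^ k)"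
    using fin B by (intro sum_mono2) (auto simp: less_Suc_eq_le)
  also have "\<dots> = B * (\<Sum>k<Suc (Max ?K). exp (- z) ^ k)" by (simp only: sum_distrib_left)
  also have "\<dots> \<le> B * (1 / (1 - exp (- z)))"
    using B z by (intro mult_left_mono sum_geometric_le) auto
  finally show ?thesis by simp
qed

text \<open>A bound on the exponent for each single length that leaves a margin \<open>z\<^sup>2 k / 4\<close> gives a bound
  for the sum over all lengths: the series over \<open>k\<close> contributes a factor of order \<open>1 / z\<close>,
  which is absorbed by \<open>exp (\<eta> / z)\<close>.  The predicate \<open>A\<close> selects the lengths to be considered.\<close>

lemma sum_tilted_weight_by_length_le:
  assumes gap: "gap_sequence qs" and \<eta>: "\<eta> > 0"
    and ev: "\<forall>\<^sub>F z in at_right 0. \<forall>k. A z k \<longrightarrow> i z \<le> k \<and> a \<le> z * real (i z) \<and>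
      z * (a * real (gap_sum qs (k - i z)) - z * real (min_weight qs k))
      + bose_int (z * real (i z)) + bose_int (z * real k - a) - bose_int (z * real (i z) - a)
      \<le> M - z * (z * real k) / 4"
  shows "\<forall>\<^sub>F z in at_right 0. \<forall>X. finite X \<longrightarrow> X \<subseteq> {p \<in> gap_partitions qs. A z (part_length p)} \<longrightarrow>
    (\<Sum>p\<in>X. tilted_weight z a (i z) p) \<le> exp ((M + \<eta>) / z)"
proof -
  have "\<forall>\<^sub>F z::real in at_right 0. 1 / (1 - exp (- (z / 4))) \<le> exp (\<eta> / z)"
    using \<eta> by real_asymp
  with ev show ?thesis using eventually_at_right_less[of "0::real"]
  proof eventually_elim
    case (elim z)
    have z: "z > 0" by fact
    show ?case
    proof (intro allI impI)
      fix X assume X: "finite X" "X \<subseteq> {p \<in> gap_partitions qs. A z (part_length p)}"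
      have "(\<Sum>p\<in>X. tilted_weight z a (i z) p) \<le> exp (M / z) / (1 - exp (- (z / 4)))"
      proof (rule sum_by_length_le)
        fix k assume "k \<in> part_length ` X"
        then have "A z k" using X by auto
        then have k: "i z \<le> k" "a \<le> z * real (i z)"
          and le: "z * (a * real (gap_sum qs (k - i z)) - z * real (min_weight qs k))
            + bose_int (z * real (i z)) + bose_int (z * real k - a) - bose_int (z * real (i z) - a)
            \<le> M - z * (z * real k) / 4"
          using elim(1) by blast+
        let ?L = "\<Sum>j<k. bose_log (rate z a (i z) j)"
        let ?E = "a * real (gap_sum qs (k - i z)) - z * real (min_weight qs k)"
        have "(\<Sum>p\<in>{p \<in> X. part_length p = k}. tilted_weight z a (i z) p) \<le> exp (?E + ?L)"
        proof (rule sum_tilted_weight_le[OF gap _ _ k(1)])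
          fix j assume "j < k"
          show "rate z a (i z) j > 0"
          proof (cases "i z \<le> j")
            case True
            then have "z * real (i z) \<le> z * real j" using z by simp
            then have "a \<le> z * real j" using k by linarith
            then show ?thesis using True k z by (simp add: rate_def distrib_left)
          qed (use z in \<open>simp add: rate_def\<close>)
        qed (use X in auto)
        also have "exp (?E + ?L) \<le> exp (M / z + - (z / 4) * real k)"
        proof -
          have "z * (?E + ?L) \<le> z * (M / z + - (z / 4) * real k)"
            using le sum_bose_log_rate_le[OF z k] z by (simp add: algebra_simps)
          then show ?thesis using z by (simp only: mult_le_cancel_left_pos exp_le_cancel_iff)
        qed
        finally show "(\<Sum>p\<in>{p \<in> X. part_length p = k}. tilted_weight z a (i z) p)
            \<le> exp (M / z) * exp (- (z / 4) * real k)"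
          by (simp only: exp_add)
      qed (use X z in auto)
      also have "\<dots> = exp (M / z) * (1 / (1 - exp (- (z / 4))))" by simp
      also have "\<dots> \<le> exp (M / z) * exp (\<eta> / z)" using elim by (intro mult_left_mono) auto
      also have "\<dots> = exp ((M + \<eta>) / z)" by (simp add: exp_add[symmetric] add_divide_distrib)
      finally show "(\<Sum>p\<in>X. tilted_weight z a (i z) p) \<le> exp ((M + \<eta>) / z)" .
    qed
  qed
qed

section \<open>Leading order of the tilted and untilted sums\<close>

text \<open>A small multiple of \<open>x\<^sup>2\<close> is absorbed by the quadratic gain in \<open>bose_int_le_theta\<close>.\<close>

lemma square_absorb:
  fixes x b q \<eta> :: real
  assumes "0 \<le> \<eta>" "\<eta> \<le> 1/4" "0 \<le> q"
  shows "\<eta> * (1 + q * x\<^sup>2) \<le> q * (x - b)\<^sup>2 / 2 + \<eta> * (1 + 2 * q * b\<^sup>2)"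
proof -
  have "x\<^sup>2 \<le> 2 * (x - b)\<^sup>2 + 2 * b\<^sup>2"
    using sum_power2_ge_zero[of "x - 2 * b" 0] by (simp add: power2_eq_square algebra_simps)
  then have "\<eta> * q * x\<^sup>2 \<le> \<eta> * q * (2 * (x - b)\<^sup>2 + 2 * b\<^sup>2)"
    using assms by (intro mult_left_mono) auto
  moreover have "\<eta> * (2 * q * (x - b)\<^sup>2) \<le> 1/4 * (2 * q * (x - b)\<^sup>2)"
    using assms by (intro mult_right_mono) auto
  ultimately show ?thesis by (simp add: algebra_simps)
qed

lemma small_slack:
  fixes \<eta> B :: real
  assumes "\<eta> > 0" "B \<ge> 0"
  obtains \<eta>' where "0 < \<eta>'" "\<eta>' \<le> 1/4" "\<eta>' * (1 + B) \<le> \<eta>"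
proof
  show "0 < min (1/4) (\<eta> / (1 + B))" using assms by auto
  show "min (1/4) (\<eta> / (1 + B)) \<le> 1/4" by (rule min.cobounded1)
  have "min (1/4) (\<eta> / (1 + B)) * (1 + B) \<le> \<eta> / (1 + B) * (1 + B)"
    using assms by (intro mult_right_mono) auto
  then show "min (1/4) (\<eta> / (1 + B)) * (1 + B) \<le> \<eta>" using assms by simp
qed

text \<open>With \<open>x = z k\<close> the exponent is, to leading order and after multiplication by \<open>z\<close>,
  \<open>- q x\<^sup>2 / 2 + a q (x - s) + I s + I (x - a) - I (s - a)\<close>.  Completing the square turns
  \<open>- q x\<^sup>2 / 2 + a q x\<close> into \<open>- q (x - a)\<^sup>2 / 2 + q a\<^sup>2 / 2\<close>, so that \<open>bose_int_le_theta\<close> at \<open>x - a\<close> bounds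
  the maximum over \<open>x\<close> without solving the tilted variational problem.\<close>

lemma tilted_sum_le:
  assumes gap: "gap_sequence qs" and growth: "linear_growth qs q" and q: "q \<ge> 0"
    and s: "s > 0" and a: "a \<le> s / 2" and \<eta>: "\<eta> > 0"
  shows "\<forall>\<^sub>F z in at_right 0. \<forall>X. finite X \<longrightarrow> X \<subseteq> {p \<in> gap_partitions qs. nat \<lfloor>s / z\<rfloor> \<le> part_length p} \<longrightarrow>
    (\<Sum>p\<in>X. tilted_weight z a (nat \<lfloor>s / z\<rfloor>) p) \<le>
      exp (((theta q)\<^sup>2 + q * a\<^sup>2 / 2 - a * q * s + bose_int s - bose_int (s - a) + \<eta>) / z)"
proof -
  let ?b = "a + T_root q"
  let ?M = "(theta q)\<^sup>2 + q * a\<^sup>2 / 2 - a * q * s + bose_int s - bose_int (s - a)"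
  obtain \<eta>' where \<eta>': "0 < \<eta>'" "\<eta>' \<le> 1/4" "\<eta>' * (1 + 2 * q * ?b\<^sup>2) \<le> \<eta> / 4"
    using small_slack[of "\<eta> / 4" "2 * q * ?b\<^sup>2"] \<eta> q by auto
  have L: "bose_log (s / 4) > 0" using s by (intro bose_log_pos) simp
  have "\<forall>\<^sub>F z in at_right 0. z \<in> {0<..<min (s / 4) (\<eta> / 4 / bose_log (s / 4))}"
    using s L \<eta> by (intro eventually_at_right_real) auto
  with gap_exponent_le[OF gap growth q s a \<eta>'(1)]
  have "\<forall>\<^sub>F z in at_right 0. \<forall>k. nat \<lfloor>s / z\<rfloor> \<le> k \<longrightarrow> nat \<lfloor>s / z\<rfloor> \<le> k \<and> a \<le> z * real (nat \<lfloor>s / z\<rfloor>) \<and>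
      z * (a * real (gap_sum qs (k - nat \<lfloor>s / z\<rfloor>)) - z * real (min_weight qs k))
      + bose_int (z * real (nat \<lfloor>s / z\<rfloor>)) + bose_int (z * real k - a) - bose_int (z * real (nat \<lfloor>s / z\<rfloor>) - a)
      \<le> (?M + \<eta> / 2) - z * (z * real k) / 4"
  proof eventually_elim
    case (elim z)
    then have z: "z > 0" "z < s / 4" "z * bose_log (s / 4) \<le> \<eta> / 4"
      using L by (auto simp: field_simps)
    show ?case
    proof (intro allI impI)
      fix k
      define i where "i = nat \<lfloor>s / z\<rfloor>"
      define x where "x = z * real k"
      assume "nat \<lfloor>s / z\<rfloor> \<le> k"
      then have ik: "i \<le> k" by (simp add: i_def)
      have i: "z * real i \<le> s" "s - z < z * real i"
        using floor_div_bounds[OF z(1) s] by (simp_all add: i_def algebra_simps)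
      have ai: "s - a - z \<le> z * real i - a" "s / 4 \<le> s - a - z" using i a z by linarith+
      have x: "z * real i \<le> x" using ik z by (simp add: x_def)
      have "bose_int (s - a) - bose_int (s - a - z) \<le> z * bose_log (s - a - z)"
        using bose_int_increment(2)[of "s - a - z" "s - a"] ai s z by simp
      also have "\<dots> \<le> z * bose_log (s / 4)"
        using ai s z by (intro mult_left_mono bose_log_antimono) auto
      finally have "bose_int (s - a) \<le> bose_int (z * real i - a) + \<eta> / 4"
        using bose_int_mono[of "s - a - z" "z * real i - a"] ai s z by linarith
      moreover have "bose_int (z * real i) \<le> bose_int s" using i z by (intro bose_int_mono) auto
      moreover have "bose_int (x - a) \<le> (theta q)\<^sup>2 + q * (x - a)\<^sup>2 / 2 - q * (x - ?b)\<^sup>2 / 2"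
        using bose_int_le_theta[OF q, of "x - a"] ai s x by (simp add: diff_diff_add)
      moreover have "z * (a * real (gap_sum qs (k - i)) - z * real (min_weight qs k)) \<le>
        - (q * x\<^sup>2 / 2) + a * q * (x - s) + \<eta>' * (1 + q * x\<^sup>2) - z * x / 4"
        using elim(1) ik unfolding x_def i_def by blast
      moreover have "\<eta>' * (1 + q * x\<^sup>2) \<le> q * (x - ?b)\<^sup>2 / 2 + \<eta>' * (1 + 2 * q * ?b\<^sup>2)"
        using \<eta>' q by (intro square_absorb) auto
      moreover have "- (q * x\<^sup>2 / 2) + a * q * (x - s) + q * (x - a)\<^sup>2 / 2 = q * a\<^sup>2 / 2 - a * q * s"
        by (simp add: power2_eq_square field_simps)
      ultimately have "z * (a * real (gap_sum qs (k - i)) - z * real (min_weight qs k))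
        + bose_int (z * real i) + bose_int (x - a) - bose_int (z * real i - a)
        \<le> (?M + \<eta> / 2) - z * x / 4"
        using \<eta>'(3) by linarith
      moreover have "a \<le> z * real i" using ai s by linarith
      ultimately show "nat \<lfloor>s / z\<rfloor> \<le> k \<and> a \<le> z * real (nat \<lfloor>s / z\<rfloor>) \<and>
        z * (a * real (gap_sum qs (k - nat \<lfloor>s / z\<rfloor>)) - z * real (min_weight qs k))
        + bose_int (z * real (nat \<lfloor>s / z\<rfloor>)) + bose_int (z * real k - a) - bose_int (z * real (nat \<lfloor>s / z\<rfloor>) - a)
        \<le> (?M + \<eta> / 2) - z * (z * real k) / 4"
        using ik unfolding x_def i_def by simp
    qed
  qed
  from sum_tilted_weight_by_length_le[OF gap _ this, of "\<eta> / 2"] \<eta>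
  show ?thesis by (simp add: add.assoc)
qed

text \<open>Common part of the following two bounds: an upper bound for \<open>I x - q x\<^sup>2 / 2\<close> over the admissible
  lengths that tolerates a small error proportional to \<open>1 + q x\<^sup>2\<close>.\<close>

lemma untilted_sum_le:
  assumes gap: "gap_sequence qs" and growth: "linear_growth qs q" and q: "q \<ge> 0" and \<eta>: "\<eta> > 0"
    and K: "\<And>\<eta>. \<eta> > 0 \<Longrightarrow> \<exists>\<eta>'>0. \<forall>z>0. \<forall>k. A z k \<longrightarrow>
      bose_int (z * real k) - q * (z * real k)\<^sup>2 / 2 + \<eta>' * (1 + q * (z * real k)\<^sup>2) \<le> M + \<eta>"
  shows "\<forall>\<^sub>F z in at_right 0. \<forall>X. finite X \<longrightarrow> X \<subseteq> {p \<in> gap_partitions qs. A z (part_length p)} \<longrightarrow>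
    (\<Sum>p\<in>X. tilted_weight z 0 0 p) \<le> exp ((M + \<eta>) / z)"
proof -
  obtain \<eta>' where \<eta>': "\<eta>' > 0" "\<And>z k. z > 0 \<Longrightarrow> A z k \<Longrightarrow>
      bose_int (z * real k) - q * (z * real k)\<^sup>2 / 2 + \<eta>' * (1 + q * (z * real k)\<^sup>2) \<le> M + \<eta> / 2"
    using K[of "\<eta> / 2"] \<eta> by auto
  have "(1::real) > 0" "(0::real) \<le> 1 / 2" by simp_all
  from gap_exponent_le[OF gap growth q this \<eta>'(1)]
  have "\<forall>\<^sub>F z in at_right 0. \<forall>k. A z k \<longrightarrow> 0 \<le> k \<and> 0 \<le> z * real (0::nat) \<and>
      z * (0 * real (gap_sum qs (k - 0)) - z * real (min_weight qs k))
      + bose_int (z * real (0::nat)) + bose_int (z * real k - 0) - bose_int (z * real (0::nat) - 0)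
      \<le> (M + \<eta> / 2) - z * (z * real k) / 4"
    using eventually_at_right_less[of "0::real"]
  proof eventually_elim
    case (elim z)
    show ?case
    proof (intro allI impI)
      fix k assume "A z k"
      have "z * (0 * real (gap_sum qs (k - 0)) - z * real (min_weight qs k)) \<le>
        - (q * (z * real k)\<^sup>2 / 2) + 0 * q * (z * real k - 1)
        + \<eta>' * (1 + q * (z * real k)\<^sup>2) - z * (z * real k) / 4"
        using elim(1) by blast
      then show "0 \<le> k \<and> 0 \<le> z * real (0::nat) \<and>
        z * (0 * real (gap_sum qs (k - 0)) - z * real (min_weight qs k))
        + bose_int (z * real (0::nat)) + bose_int (z * real k - 0) - bose_int (z * real (0::nat) - 0)
        \<le> (M + \<eta> / 2) - z * (z * real k) / 4"
        using \<eta>'(2)[OF elim(2) \<open>A z k\<close>] by simp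
    qed
  qed
  from sum_tilted_weight_by_length_le[OF gap _ this, of "\<eta> / 2"] \<eta>
  show ?thesis by (simp add: add.assoc)
qed

lemma total_sum_le:
  assumes gap: "gap_sequence qs" and growth: "linear_growth qs q" and q: "q \<ge> 0" and \<eta>: "\<eta> > 0"
  shows "\<forall>\<^sub>F z in at_right 0. \<forall>X. finite X \<longrightarrow> X \<subseteq> gap_partitions qs \<longrightarrow>
    (\<Sum>p\<in>X. tilted_weight z 0 0 p) \<le> exp (((theta q)\<^sup>2 + \<eta>) / z)"
proof -
  have "\<exists>\<eta>'>0. \<forall>z>0. \<forall>k. True \<longrightarrow>
    bose_int (z * real k) - q * (z * real k)\<^sup>2 / 2 + \<eta>' * (1 + q * (z * real k)\<^sup>2) \<le> (theta q)\<^sup>2 + \<eta>"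
    if \<eta>: "\<eta> > 0" for \<eta>
  proof -
    let ?T = "T_root q"
    obtain \<eta>' where \<eta>': "0 < \<eta>'" "\<eta>' \<le> 1/4" "\<eta>' * (1 + 2 * q * ?T\<^sup>2) \<le> \<eta>"
      using small_slack[of \<eta> "2 * q * ?T\<^sup>2"] \<eta> q by auto
    have "bose_int x - q * x\<^sup>2 / 2 + \<eta>' * (1 + q * x\<^sup>2) \<le> (theta q)\<^sup>2 + \<eta>" if "x \<ge> 0" for x
      using bose_int_le_theta[OF q that] square_absorb[of \<eta>' q x ?T] \<eta>' q by linarith
    then show ?thesis using \<eta>'(1) by (intro exI[of _ \<eta>']) auto
  qed
  from untilted_sum_le[OF gap growth q \<eta>, where A = "\<lambda>_ _. True", OF this] show ?thesis by simp
qed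

text \<open>If \<open>q s \<le> L s\<close>, then \<open>I x - q x\<^sup>2 / 2\<close> increases up to \<open>s\<close>, so that among partitions with at most
  \<open>s / z\<close> parts the longest dominate.\<close>

lemma short_sum_le:
  assumes gap: "gap_sequence qs" and growth: "linear_growth qs q" and q: "q \<ge> 0" and \<eta>: "\<eta> > 0"
    and s: "s > 0" "bose_log s \<ge> q * s"
  shows "\<forall>\<^sub>F z in at_right 0. \<forall>X. finite X \<longrightarrow>
    X \<subseteq> {p \<in> gap_partitions qs. part_length p \<le> nat \<lfloor>s / z\<rfloor>} \<longrightarrow>
    (\<Sum>p\<in>X. tilted_weight z 0 0 p) \<le> exp ((bose_int s - q * s\<^sup>2 / 2 + \<eta>) / z)"
proof -
  have "\<exists>\<eta>'>0. \<forall>z>0. \<forall>k. k \<le> nat \<lfloor>s / z\<rfloor> \<longrightarrow>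
    bose_int (z * real k) - q * (z * real k)\<^sup>2 / 2 + \<eta>' * (1 + q * (z * real k)\<^sup>2)
      \<le> (bose_int s - q * s\<^sup>2 / 2) + \<eta>"
    if \<eta>: "\<eta> > 0" for \<eta>
  proof -
    obtain \<eta>' where \<eta>': "0 < \<eta>'" "\<eta>' * (1 + q * s\<^sup>2) \<le> \<eta>"
      using small_slack[of \<eta> "q * s\<^sup>2"] \<eta> q by auto
    have "bose_int x - q * x\<^sup>2 / 2 + \<eta>' * (1 + q * x\<^sup>2) \<le> (bose_int s - q * s\<^sup>2 / 2) + \<eta>"
      if x: "0 \<le> x" "x \<le> s" for x
    proof -
      have "(s - x) * (q * s) \<le> (s - x) * bose_log s" using s x by (intro mult_left_mono) auto
      then have 1: "(s - x) * (q * s) \<le> bose_int s - bose_int x"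
        using bose_int_increment_ge[OF x s(1)] by linarith
      have 2: "q * s\<^sup>2 / 2 - q * x\<^sup>2 / 2 \<le> (s - x) * (q * s)"
      proof -
        have "0 \<le> q * (s - x)\<^sup>2" using q by simp
        also have "q * (s - x)\<^sup>2 = 2 * ((s - x) * (q * s)) - (q * s\<^sup>2 - q * x\<^sup>2)"
          by (simp add: power2_eq_square algebra_simps)
        finally show ?thesis by linarith
      qed
      have "x\<^sup>2 \<le> s\<^sup>2" using x by (intro power_mono) auto
      then have "\<eta>' * (1 + q * x\<^sup>2) \<le> \<eta>' * (1 + q * s\<^sup>2)"
        using q \<eta>' by (intro mult_left_mono add_mono) auto
      then show ?thesis using 1 2 \<eta>' by linarith
    qed
    moreover have "z * real k \<le> s" if "z > 0" "k \<le> nat \<lfloor>s / z\<rfloor>" for z k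
    proof -
      have "z * real k \<le> z * real (nat \<lfloor>s / z\<rfloor>)" using that by simp
      then show ?thesis using floor_div_bounds(1)[OF \<open>z > 0\<close> s(1)] by linarith
    qed
    ultimately show ?thesis using \<eta>'(1) by (intro exI[of _ \<eta>']) auto
  qed
  from untilted_sum_le[OF gap growth q \<eta>, where A = "\<lambda>z k. k \<le> nat \<lfloor>s / z\<rfloor>", OF this] show ?thesis by simp
qed

lemma near_optimal_length:
  assumes q: "q \<ge> 0" and \<eta>: "\<eta> > 0"
  obtains x where "x > 0" "bose_int x - q * x\<^sup>2 / 2 > (theta q)\<^sup>2 - \<eta>"
proof (cases "q = 0")
  case True
  have "\<forall>\<^sub>F x in at_top. bose_int x > (theta q)\<^sup>2 - \<eta>"
    using bose_int_tendsto_at_top \<eta> True theta_squared[of q] by (intro order_tendstoD(1)) auto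
  then have "\<forall>\<^sub>F x in at_top. bose_int x > (theta q)\<^sup>2 - \<eta> \<and> x > 0"
    using eventually_gt_at_top by (rule eventually_conj)
  then obtain x where "bose_int x > (theta q)\<^sup>2 - \<eta>" "x > 0" by (auto dest: eventually_happens)
  then show ?thesis using that True by simp
next
  case False
  then show ?thesis using that[of "T_root q"] theta_squared[OF q] T_root_pos q \<eta> by simp
qed

text \<open>A single length suffices, namely one for which \<open>z k\<close> is close to a near-maximiser of \<open>I x - q x\<^sup>2 / 2\<close>.\<close>

lemma total_sum_ge:
  assumes gap: "gap_sequence qs" and growth: "linear_growth qs q" and q: "q \<ge> 0" and \<eta>: "\<eta> > 0"
  shows "\<forall>\<^sub>F z in at_right 0. \<exists>X. finite X \<and> X \<subseteq> gap_partitions qs \<and>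
    exp (((theta q)\<^sup>2 - \<eta>) / z) \<le> (\<Sum>p\<in>X. tilted_weight z 0 0 p)"
proof -
  obtain x where x: "x > 0" "bose_int x - q * x\<^sup>2 / 2 > (theta q)\<^sup>2 - \<eta> / 3"
    using near_optimal_length[OF q, of "\<eta> / 3"] \<eta> by auto
  obtain \<eta>' where \<eta>': "0 < \<eta>'" "\<eta>' * (1 + (x\<^sup>2 + x) / 2) \<le> \<eta> / 3"
    using small_slack[of "\<eta> / 3" "(x\<^sup>2 + x) / 2"] \<eta> x by auto
  obtain C where C: "C \<ge> 0" "\<And>k. \<bar>real (gap_sum qs k) - q * real k\<bar> \<le> \<eta>' * real k + C"
    using growth \<eta>' unfolding linear_growth_def by blast
  have "((\<lambda>z. bose_int z + z * (q * x / 2 + C * x + ln 2)) \<longlongrightarrow> 0 + 0 * (q * x / 2 + C * x + ln 2)) (at_right 0)"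
    by (intro tendsto_intros bose_int_tendsto_at_right_0)
  then have "\<forall>\<^sub>F z in at_right 0. bose_int z + z * (q * x / 2 + C * x + ln 2) < \<eta> / 3"
    using \<eta> by (intro order_tendstoD(2)) auto
  moreover have "\<forall>\<^sub>F z::real in at_right 0. z \<in> {0<..<1}"
    by (intro eventually_at_right_real) auto
  ultimately show ?thesis
  proof eventually_elim
    case (elim z)
    then have z: "z > 0" "z < 1" by auto
    define k where "k = nat \<lfloor>x / z\<rfloor>"
    define y where "y = z * real k"
    have y: "0 \<le> y" "y \<le> x" "x \<le> z * real (Suc k)"
      using floor_div_bounds[OF z(1) x(1)] z by (auto simp: k_def y_def)
    let ?S = "real (min_weight qs k)" and ?L = "\<Sum>j<k. bose_log (z * real (Suc j))"
    have "?S \<le> q * real k * (real k + 1) / 2 + (\<eta>' * real k * (real k + 1) / 2 + C * real k)"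
      using min_weight_estimate[OF C(2), of k] by linarith
    then have "z * (z * ?S) \<le>
        z * (z * (q * real k * (real k + 1) / 2 + (\<eta>' * real k * (real k + 1) / 2 + C * real k)))"
      using z by (intro mult_left_mono) auto
    also have "\<dots> = q * y\<^sup>2 / 2 + q * (y * z) / 2 + \<eta>' * ((y\<^sup>2 + y * z) / 2) + C * (y * z)"
      unfolding y_def by (simp add: field_simps power2_eq_square)
    also have "\<dots> \<le> q * x\<^sup>2 / 2 + q * (x * z) / 2 + \<eta>' * ((x\<^sup>2 + x * 1) / 2) + C * (x * z)"
      using q y z \<eta>' C by (intro add_mono mult_left_mono divide_right_mono mult_mono power_mono) auto
    finally have "z * (z * ?S) \<le> q * x\<^sup>2 / 2 + q * (x * z) / 2 + \<eta>' * ((x\<^sup>2 + x) / 2) + C * (x * z)"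
      by simp
    moreover have "bose_int x - bose_int z \<le> z * ?L"
      using sum_bose_log_ge[OF z(1), of k] bose_int_mono[of x "z * real (Suc k)"] x y by linarith
    moreover have "bose_int z + (q * (x * z) / 2 + C * (x * z) + z * ln 2) < \<eta> / 3"
      using elim by (simp add: algebra_simps)
    moreover have "\<eta>' * ((x\<^sup>2 + x) / 2) \<le> \<eta> / 3"
    proof -
      have "\<eta>' * ((x\<^sup>2 + x) / 2) \<le> \<eta>' * (1 + (x\<^sup>2 + x) / 2)"
        using \<eta>'(1) by (intro mult_left_mono) auto
      then show ?thesis using \<eta>'(2) by linarith
    qed
    ultimately have "(theta q)\<^sup>2 - \<eta> \<le> z * ?L - z * (z * ?S) - z * ln 2"
      using x(2) by linarith
    then have "((theta q)\<^sup>2 - \<eta>) / z \<le> (?L - z * ?S) - ln 2"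
      using z by (simp add: field_simps)
    then have "exp (((theta q)\<^sup>2 - \<eta>) / z) \<le> exp ((?L - z * ?S) - ln 2)" by simp
    also have "\<dots> = exp (?L - z * ?S) / 2" by (simp add: exp_diff)
    finally have le: "exp (((theta q)\<^sup>2 - \<eta>) / z) \<le> exp (?L - z * ?S) / 2" .
    obtain X where "finite X" "X \<subseteq> gap_partitions qs"
      "exp (?L - z * ?S) / 2 \<le> (\<Sum>p\<in>X. tilted_weight z 0 0 p)"
      using finite_subset_sum_weight_ge[OF gap z(1), of k] .
    then show ?case using order_trans[OF le] by blast
  qed
qed

section \<open>Exponentially negligible families and one-point deviations\<close>

text \<open>The Boltzmann weight of the partitions in \<open>S z\<close> is smaller than that of the whole class by a
  factor \<open>exp (- c / z)\<close>; compare \<open>total_sum_ge\<close>.\<close>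

definition negligible_family :: "(nat \<Rightarrow> nat) \<Rightarrow> real \<Rightarrow> (real \<Rightarrow> (nat \<Rightarrow> nat) set) \<Rightarrow> bool" where
  "negligible_family qs q S \<longleftrightarrow> (\<exists>c>0. \<forall>\<^sub>F z in at_right 0. \<forall>X. finite X \<longrightarrow> X \<subseteq> gap_partitions qs \<inter> S z \<longrightarrow>
     (\<Sum>p\<in>X. tilted_weight z 0 0 p) \<le> exp (((theta q)\<^sup>2 - c) / z))"

lemma negligible_family_empty: "negligible_family qs q (\<lambda>_. {})"
  unfolding negligible_family_def by (intro exI[of _ 1]) auto

lemma negligible_family_subset:
  assumes "negligible_family qs q S'" "\<And>z. S z \<subseteq> S' z"
  shows "negligible_family qs q S"
proof -
  obtain c where "c > 0" and ev: "\<forall>\<^sub>F z in at_right 0. \<forall>X. finite X \<longrightarrow> X \<subseteq> gap_partitions qs \<inter> S' z \<longrightarrow>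
      (\<Sum>p\<in>X. tilted_weight z 0 0 p) \<le> exp (((theta q)\<^sup>2 - c) / z)"
    using assms(1) unfolding negligible_family_def by blast
  from ev have "\<forall>\<^sub>F z in at_right 0. \<forall>X. finite X \<longrightarrow> X \<subseteq> gap_partitions qs \<inter> S z \<longrightarrow>
      (\<Sum>p\<in>X. tilted_weight z 0 0 p) \<le> exp (((theta q)\<^sup>2 - c) / z)"
  proof eventually_elim
    case (elim z)
    show ?case
    proof (intro allI impI)
      fix X assume X: "finite X" "X \<subseteq> gap_partitions qs \<inter> S z"
      have "X \<subseteq> gap_partitions qs \<inter> S' z" using X(2) assms(2)[of z] by auto
      then show "(\<Sum>p\<in>X. tilted_weight z 0 0 p) \<le> exp (((theta q)\<^sup>2 - c) / z)"
        using elim X(1) by simp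
    qed
  qed
  then show ?thesis using \<open>c > 0\<close> unfolding negligible_family_def by blast
qed

lemma negligible_family_Un:
  assumes "negligible_family qs q S" "negligible_family qs q S'"
  shows "negligible_family qs q (\<lambda>z. S z \<union> S' z)"
proof -
  obtain c c' where c: "c > 0" "c' > 0"
    and ev: "\<forall>\<^sub>F z in at_right 0. \<forall>X. finite X \<longrightarrow> X \<subseteq> gap_partitions qs \<inter> S z \<longrightarrow>
      (\<Sum>p\<in>X. tilted_weight z 0 0 p) \<le> exp (((theta q)\<^sup>2 - c) / z)"
    and ev': "\<forall>\<^sub>F z in at_right 0. \<forall>X. finite X \<longrightarrow> X \<subseteq> gap_partitions qs \<inter> S' z \<longrightarrow>
      (\<Sum>p\<in>X. tilted_weight z 0 0 p) \<le> exp (((theta q)\<^sup>2 - c') / z)"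
    using assms unfolding negligible_family_def by blast
  define d where "d = min c c' / 2"
  have d: "d > 0" "2 * d \<le> c" "2 * d \<le> c'" using c by (auto simp: d_def)
  have "\<forall>\<^sub>F z::real in at_right 0. 2 \<le> exp (d / z)" using d(1) by real_asymp
  with ev ev' have "\<forall>\<^sub>F z in at_right 0. \<forall>X. finite X \<longrightarrow> X \<subseteq> gap_partitions qs \<inter> (S z \<union> S' z) \<longrightarrow>
      (\<Sum>p\<in>X. tilted_weight z 0 0 p) \<le> exp (((theta q)\<^sup>2 - d) / z)"
    using eventually_at_right_less[of "0::real"]
  proof eventually_elim
    case (elim z)
    have z: "z > 0" by fact
    show ?case
    proof (intro allI impI)
      fix X assume X: "finite X" "X \<subseteq> gap_partitions qs \<inter> (S z \<union> S' z)"
      let ?f = "\<lambda>p. tilted_weight z 0 0 p" and ?B = "exp (((theta q)\<^sup>2 - 2 * d) / z)"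
      have "sum ?f X = sum ?f (X \<inter> S z) + sum ?f (X - S z)"
        using X(1) by (rule sum.Int_Diff)
      moreover have "sum ?f (X \<inter> S z) \<le> exp (((theta q)\<^sup>2 - c) / z)"
        by (rule elim(1)[rule_format]) (use X in auto)
      moreover have "sum ?f (X - S z) \<le> exp (((theta q)\<^sup>2 - c') / z)"
        by (rule elim(2)[rule_format]) (use X in auto)
      moreover have "exp (((theta q)\<^sup>2 - c) / z) \<le> ?B" "exp (((theta q)\<^sup>2 - c') / z) \<le> ?B"
        using d z by (auto intro!: divide_right_mono)
      ultimately have "sum ?f X \<le> 2 * ?B" by linarith
      also have "\<dots> \<le> exp (d / z) * ?B" using elim by (intro mult_right_mono) auto
      also have "\<dots> = exp (((theta q)\<^sup>2 - d) / z)"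
        by (simp add: exp_add[symmetric] add_divide_distrib[symmetric])
      finally show "sum ?f X \<le> exp (((theta q)\<^sup>2 - d) / z)" .
    qed
  qed
  then show ?thesis using d(1) unfolding negligible_family_def by blast
qed

lemma negligible_family_UN:
  assumes "finite G" "\<And>s. s \<in> G \<Longrightarrow> negligible_family qs q (S s)"
  shows "negligible_family qs q (\<lambda>z. \<Union>s\<in>G. S s z)"
  using assms
proof (induction G rule: finite_induct)
  case (insert s G)
  then have "negligible_family qs q (\<lambda>z. S s z \<union> (\<Union>s\<in>G. S s z))"
    by (intro negligible_family_Un) auto
  then show ?case by simp
qed (simp add: negligible_family_empty)

lemma chernoff_sum_le:
  assumes "z > 0" "finite X" "\<And>p. p \<in> X \<Longrightarrow> b \<le> a * (z * real (p i))"
  shows "(\<Sum>p\<in>X. tilted_weight z 0 0 p) \<le> exp (- b / z) * (\<Sum>p\<in>X. tilted_weight z a i p)"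
  unfolding sum_distrib_left
proof (rule sum_mono)
  fix p assume "p \<in> X"
  then have "b / z \<le> a * real (p i)" using assms(1,3) by (simp add: field_simps)
  then show "tilted_weight z 0 0 p \<le> exp (- b / z) * tilted_weight z a i p"
    by (simp add: tilted_weight_def exp_add[symmetric])
qed

lemma bose_log_shift_tendsto:
  assumes "s > 0"
  shows "((\<lambda>a. bose_log (s + c * a)) \<longlongrightarrow> bose_log s) (at_right 0)"
proof -
  have "isCont bose_log s"
    using continuous_on_bose_log assms by (simp add: continuous_on_eq_continuous_at)
  moreover have "((\<lambda>a. s + c * a) \<longlongrightarrow> s + c * 0) (at_right 0)"
    by (intro tendsto_intros)
  ultimately show ?thesis by (intro isCont_tendsto_compose[of s bose_log]) auto
qed

text \<open>The tilt by \<open>a > 0\<close> costs at most \<open>a (\<phi> s + \<epsilon> / 4)\<close> when \<open>a\<close> is small, and the event gains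
  \<open>a (\<phi> s + \<epsilon>)\<close>.  If the part with index \<open>i\<close> exceeds a positive bound, then the length exceeds \<open>i\<close>, so
  that the tilted estimate for long partitions applies.\<close>

lemma negligible_above:
  assumes gap: "gap_sequence qs" and growth: "linear_growth qs q" and q: "q \<ge> 0"
    and s: "s > 0" and \<epsilon>: "\<epsilon> > 0"
  shows "negligible_family qs q (\<lambda>z. {p. z * real (p (nat \<lfloor>s / z\<rfloor>)) > limit_shape q s + \<epsilon>})"
proof -
  let ?\<phi> = "limit_shape q s"
  have \<phi>: "?\<phi> \<ge> 0" "bose_log s - q * s \<le> ?\<phi>" using limit_shape_eq_max[OF q s] by auto
  have "((\<lambda>a. bose_log (s + (-1) * a) + q * a / 2) \<longlongrightarrow> bose_log s + q * 0 / 2) (at_right 0)"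
    by (rule tendsto_add[OF bose_log_shift_tendsto[OF s]]) (intro tendsto_intros, simp)
  then have "\<forall>\<^sub>F a in at_right 0. bose_log (s + (-1) * a) + q * a / 2 < bose_log s + \<epsilon> / 4"
    using \<epsilon> by (intro order_tendstoD(2)) auto
  moreover have "\<forall>\<^sub>F a in at_right 0. a \<in> {0<..<s / 2}"
    using s by (intro eventually_at_right_real) auto
  ultimately have "\<forall>\<^sub>F a in at_right 0. bose_log (s + (-1) * a) + q * a / 2 < bose_log s + \<epsilon> / 4 \<and> a \<in> {0<..<s / 2}"
    by (rule eventually_conj)
  then obtain a where a: "bose_log (s - a) + q * a / 2 < bose_log s + \<epsilon> / 4" "0 < a" "a < s / 2"
    by (auto dest: eventually_happens)
  let ?M = "(theta q)\<^sup>2 + q * a\<^sup>2 / 2 - a * q * s + bose_int s - bose_int (s - a)"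
  have M: "?M \<le> (theta q)\<^sup>2 + a * (?\<phi> + \<epsilon> / 4)"
  proof -
    have "bose_int s - bose_int (s - a) \<le> a * bose_log (s - a)"
      using bose_int_increment(2)[of "s - a" s] a s by simp
    moreover have "a * (bose_log (s - a) + q * a / 2 - q * s) \<le> a * (?\<phi> + \<epsilon> / 4)"
      using a \<phi> by (intro mult_left_mono) auto
    moreover have "a * (bose_log (s - a) + q * a / 2 - q * s) = a * bose_log (s - a) + q * a\<^sup>2 / 2 - a * q * s"
      by (simp add: power2_eq_square algebra_simps)
    ultimately show ?thesis by linarith
  qed
  define c where "c = a * \<epsilon> / 2"
  have c: "c > 0" using a \<epsilon> by (simp add: c_def)
  have "a \<le> s / 2" "a * \<epsilon> / 4 > 0" using a \<epsilon> by auto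
  from tilted_sum_le[OF gap growth q s this]
  have "\<forall>\<^sub>F z in at_right 0. \<forall>X. finite X \<longrightarrow>
      X \<subseteq> gap_partitions qs \<inter> {p. z * real (p (nat \<lfloor>s / z\<rfloor>)) > ?\<phi> + \<epsilon>} \<longrightarrow>
      (\<Sum>p\<in>X. tilted_weight z 0 0 p) \<le> exp (((theta q)\<^sup>2 - c) / z)"
    using eventually_at_right_less[of "0::real"]
  proof eventually_elim
    case (elim z)
    have z: "z > 0" by fact
    define i where "i = nat \<lfloor>s / z\<rfloor>"
    show ?case unfolding i_def[symmetric]
    proof (intro allI impI)
      fix X assume X: "finite X" "X \<subseteq> gap_partitions qs \<inter> {p. z * real (p i) > ?\<phi> + \<epsilon>}"
      have "i \<le> part_length p" if "p \<in> X" for p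
      proof -
        have p: "p \<in> gap_partitions qs" "?\<phi> + \<epsilon> < z * real (p i)" using X that by auto
        then have "z * real (p i) > 0" using \<phi> \<epsilon> by linarith
        then have "p i > 0" using z by (simp add: zero_less_mult_iff)
        then show ?thesis using part_pos_iff[of p i] p(1)
          by (simp add: gap_partitions_def)
      qed
      then have "X \<subseteq> {p \<in> gap_partitions qs. i \<le> part_length p}" using X by auto
      then have le: "(\<Sum>p\<in>X. tilted_weight z a i p) \<le> exp ((?M + a * \<epsilon> / 4) / z)"
        using elim(1) X(1) unfolding i_def by blast
      have "(\<Sum>p\<in>X. tilted_weight z 0 0 p) \<le> exp (- (a * (?\<phi> + \<epsilon>)) / z) * (\<Sum>p\<in>X. tilted_weight z a i p)"
        using X a z by (intro chernoff_sum_le) (auto intro!: mult_left_mono)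
      also have "\<dots> \<le> exp (- (a * (?\<phi> + \<epsilon>)) / z) * exp ((?M + a * \<epsilon> / 4) / z)"
        using le by (intro mult_left_mono) auto
      also have "\<dots> = exp ((?M + a * \<epsilon> / 4 - a * (?\<phi> + \<epsilon>)) / z)"
        by (simp add: exp_add[symmetric] add_divide_distrib diff_divide_distrib)
      also have "\<dots> \<le> exp (((theta q)\<^sup>2 - c) / z)"
      proof -
        have "a * (?\<phi> + \<epsilon> / 4) + a * \<epsilon> / 4 - a * (?\<phi> + \<epsilon>) = - c"
          by (simp add: c_def field_simps)
        then have "?M + a * \<epsilon> / 4 - a * (?\<phi> + \<epsilon>) \<le> (theta q)\<^sup>2 - c" using M by linarith
        then show ?thesis using z by (simp add: divide_right_mono)
      qed
      finally show "(\<Sum>p\<in>X. tilted_weight z 0 0 p) \<le> exp (((theta q)\<^sup>2 - c) / z)" .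
    qed
  qed
  then show ?thesis using c unfolding negligible_family_def by blast
qed

text \<open>A point at which \<open>L s > q s\<close> is not a maximiser of \<open>I x - q x\<^sup>2 / 2\<close>, whose derivative is \<open>L x - q x\<close>.\<close>

lemma bose_int_less_theta:
  assumes q: "q \<ge> 0" and s: "s > 0" "bose_log s > q * s"
  shows "bose_int s - q * s\<^sup>2 / 2 < (theta q)\<^sup>2"
proof (cases "q = 0")
  case True
  have "0 < (s + 1 - s) * bose_log (s + 1)" using bose_log_pos[of "s + 1"] s by simp
  then have "bose_int s < bose_int (s + 1)"
    using bose_int_increment(1)[of s "s + 1"] s by linarith
  also have "\<dots> \<le> (theta q)\<^sup>2" using bose_int_le[of "s + 1"] s True theta_squared[OF q] by simp
  finally show ?thesis using True by simp
next
  case False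
  then have "s \<noteq> T_root q" using bose_log_T_root[of q] q s by auto
  then have "q * (s - T_root q)\<^sup>2 / 2 > 0" using q False by simp
  then show ?thesis using bose_int_le_theta[OF q, of s] s by linarith
qed

text \<open>Only the case \<open>\<phi> s > 0\<close> matters.  Partitions of length at least \<open>s / z\<close> are handled by a tilt with
  a negative parameter; shorter ones are negligible as a whole, since their lengths are
  bounded away from the maximiser.\<close>

lemma negligible_below:
  assumes gap: "gap_sequence qs" and growth: "linear_growth qs q" and q: "q \<ge> 0"
    and s: "s > 0" and \<epsilon>: "\<epsilon> > 0"
  shows "negligible_family qs q (\<lambda>z. {p. 0 \<le> z \<and> z * real (p (nat \<lfloor>s / z\<rfloor>)) < limit_shape q s - \<epsilon>})"
proof (cases "bose_log s > q * s")
  case False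
  then have "limit_shape q s = 0" using limit_shape_eq_max[OF q s] by auto
  have "{p. 0 \<le> z \<and> z * real (p (nat \<lfloor>s / z\<rfloor>)) < limit_shape q s - \<epsilon>} = {}" for z
  proof (rule equals0I)
    fix p assume "p \<in> {p. 0 \<le> z \<and> z * real (p (nat \<lfloor>s / z\<rfloor>)) < limit_shape q s - \<epsilon>}"
    then have "0 \<le> z * real (p (nat \<lfloor>s / z\<rfloor>))" "z * real (p (nat \<lfloor>s / z\<rfloor>)) < limit_shape q s - \<epsilon>"
      by simp_all
    then show False using \<epsilon> \<open>limit_shape q s = 0\<close> by linarith
  qed
  then show ?thesis by (simp only: negligible_family_empty)
next
  case True
  let ?\<phi> = "limit_shape q s"
  have \<phi>: "?\<phi> = bose_log s - q * s" using limit_shape_eq_max[OF q s] True by auto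
  have "((\<lambda>a. bose_log (s + 1 * a) - q * a / 2) \<longlongrightarrow> bose_log s - q * 0 / 2) (at_right 0)"
    by (rule tendsto_diff[OF bose_log_shift_tendsto[OF s]]) (intro tendsto_intros, simp)
  then have "\<forall>\<^sub>F a in at_right 0. bose_log (s + 1 * a) - q * a / 2 > bose_log s - \<epsilon> / 4"
    using \<epsilon> by (intro order_tendstoD(1)) auto
  then have "\<forall>\<^sub>F a in at_right 0. bose_log (s + 1 * a) - q * a / 2 > bose_log s - \<epsilon> / 4 \<and> 0 < a"
    using eventually_at_right_less[of "0::real"] by (rule eventually_conj)
  then obtain a where a: "bose_log (s + a) - q * a / 2 > bose_log s - \<epsilon> / 4" "0 < a"
    by (auto dest: eventually_happens)
  let ?M = "(theta q)\<^sup>2 + q * (-a)\<^sup>2 / 2 - (-a) * q * s + bose_int s - bose_int (s - (-a))"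
  have M: "?M \<le> (theta q)\<^sup>2 - a * (?\<phi> - \<epsilon> / 4)"
  proof -
    have "a * bose_log (s + a) \<le> bose_int (s + a) - bose_int s"
      using bose_int_increment(1)[of s "s + a"] a s by simp
    moreover have "a * (?\<phi> - \<epsilon> / 4) \<le> a * (bose_log (s + a) - q * a / 2 - q * s)"
      using a \<phi> by (intro mult_left_mono) auto
    moreover have "a * (bose_log (s + a) - q * a / 2 - q * s) = a * bose_log (s + a) - q * a\<^sup>2 / 2 - a * q * s"
      by (simp add: power2_eq_square algebra_simps)
    ultimately show ?thesis by simp
  qed
  define c where "c = a * \<epsilon> / 2"
  have c: "c > 0" using a \<epsilon> by (simp add: c_def)
  \<comment> \<open>Half of the gap to the maximum, so that an error of the same size still leaves a gap.\<close>
  define c' where "c' = ((theta q)\<^sup>2 - (bose_int s - q * s\<^sup>2 / 2)) / 2"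
  have c': "c' > 0" using bose_int_less_theta[OF q s True] by (simp add: c'_def)
  have "- a \<le> s / 2" "a * \<epsilon> / 4 > 0" using a \<epsilon> s by auto
  from tilted_sum_le[OF gap growth q s this]
  have "\<forall>\<^sub>F z in at_right 0. \<forall>X. finite X \<longrightarrow>
      X \<subseteq> gap_partitions qs \<inter> {p. nat \<lfloor>s / z\<rfloor> \<le> part_length p \<and> z * real (p (nat \<lfloor>s / z\<rfloor>)) < ?\<phi> - \<epsilon>} \<longrightarrow>
      (\<Sum>p\<in>X. tilted_weight z 0 0 p) \<le> exp (((theta q)\<^sup>2 - c) / z)"
    using eventually_at_right_less[of "0::real"]
  proof eventually_elim
    case (elim z)
    have z: "z > 0" by fact
    define i where "i = nat \<lfloor>s / z\<rfloor>"
    show ?case unfolding i_def[symmetric]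
    proof (intro allI impI)
      fix X assume X: "finite X"
        "X \<subseteq> gap_partitions qs \<inter> {p. i \<le> part_length p \<and> z * real (p i) < ?\<phi> - \<epsilon>}"
      then have "X \<subseteq> {p \<in> gap_partitions qs. i \<le> part_length p}" by auto
      then have le: "(\<Sum>p\<in>X. tilted_weight z (- a) i p) \<le> exp ((?M + a * \<epsilon> / 4) / z)"
        using elim(1) X(1) unfolding i_def by blast
      have "(\<Sum>p\<in>X. tilted_weight z 0 0 p) \<le>
          exp (- (- a * (?\<phi> - \<epsilon>)) / z) * (\<Sum>p\<in>X. tilted_weight z (- a) i p)"
      proof (rule chernoff_sum_le[OF z X(1)])
        fix p assume "p \<in> X"
        then have "z * real (p i) \<le> ?\<phi> - \<epsilon>" using X by auto
        then show "- a * (?\<phi> - \<epsilon>) \<le> - a * (z * real (p i))"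
          using a by (intro mult_left_mono_neg) auto
      qed
      also have "\<dots> \<le> exp (- (- a * (?\<phi> - \<epsilon>)) / z) * exp ((?M + a * \<epsilon> / 4) / z)"
        using le by (intro mult_left_mono) auto
      also have "\<dots> = exp ((?M + a * \<epsilon> / 4 + a * (?\<phi> - \<epsilon>)) / z)"
        by (simp add: exp_add[symmetric] add_divide_distrib diff_divide_distrib)
      also have "\<dots> \<le> exp (((theta q)\<^sup>2 - c) / z)"
      proof -
        have "- (a * (?\<phi> - \<epsilon> / 4)) + a * \<epsilon> / 4 + a * (?\<phi> - \<epsilon>) = - c"
          by (simp add: c_def field_simps)
        then have "?M + a * \<epsilon> / 4 + a * (?\<phi> - \<epsilon>) \<le> (theta q)\<^sup>2 - c" using M by linarith
        then show ?thesis using z by (simp add: divide_right_mono)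
      qed
      finally show "(\<Sum>p\<in>X. tilted_weight z 0 0 p) \<le> exp (((theta q)\<^sup>2 - c) / z)" .
    qed
  qed
  then have long: "negligible_family qs q
      (\<lambda>z. {p. nat \<lfloor>s / z\<rfloor> \<le> part_length p \<and> z * real (p (nat \<lfloor>s / z\<rfloor>)) < ?\<phi> - \<epsilon>})"
    using c unfolding negligible_family_def by blast
  have "bose_log s \<ge> q * s" using True by simp
  from short_sum_le[OF gap growth q c' s this]
  have "\<forall>\<^sub>F z in at_right 0. \<forall>X. finite X \<longrightarrow> X \<subseteq> gap_partitions qs \<inter> {p. part_length p \<le> nat \<lfloor>s / z\<rfloor>} \<longrightarrow>
      (\<Sum>p\<in>X. tilted_weight z 0 0 p) \<le> exp (((theta q)\<^sup>2 - c') / z)"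
  proof eventually_elim
    case (elim z)
    have "bose_int s - q * s\<^sup>2 / 2 + c' = (theta q)\<^sup>2 - c'" by (simp add: c'_def field_simps)
    moreover have "{p \<in> gap_partitions qs. part_length p \<le> nat \<lfloor>s / z\<rfloor>} =
        gap_partitions qs \<inter> {p. part_length p \<le> nat \<lfloor>s / z\<rfloor>}" by auto
    ultimately show ?case using elim by (simp only:)
  qed
  then have short: "negligible_family qs q (\<lambda>z. {p. part_length p \<le> nat \<lfloor>s / z\<rfloor>})"
    using c' unfolding negligible_family_def by blast
  show ?thesis
    by (rule negligible_family_subset[OF negligible_family_Un[OF long short]]) auto
qed

section \<open>From finitely many points to uniform deviations\<close>

text \<open>The argument of the Glivenko-Cantelli theorem: choose points between which \<open>\<phi>\<close> drops by less
  than \<open>\<epsilon> / 2\<close> and a last point where \<open>\<phi>\<close> is below \<open>\<epsilon> / 2\<close>.  For an antitone \<open>f\<close> a deviation at \<open>t\<close>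
  forces one at a neighbouring chosen point.\<close>

lemma limit_shape_net:
  assumes q: "q \<ge> 0" and t: "t\<^sub>0 > 0" and \<epsilon>: "\<epsilon> > 0"
  obtains G where "finite G" "G \<subseteq> {t\<^sub>0..}"
    "\<forall>f t. (\<forall>x y. t\<^sub>0 \<le> x \<longrightarrow> x \<le> y \<longrightarrow> f y \<le> f x) \<longrightarrow> (\<forall>x. 0 \<le> f x) \<longrightarrow> t\<^sub>0 \<le> t \<longrightarrow>
      \<bar>f t - limit_shape q t\<bar> > \<epsilon> \<longrightarrow> (\<exists>s\<in>G. \<bar>f s - limit_shape q s\<bar> > \<epsilon> / 2)"
proof -
  let ?\<phi> = "limit_shape q"
  have "\<forall>\<^sub>F t in at_top. ?\<phi> t < \<epsilon> / 2"
    using limit_shape_tendsto_0[OF q] \<epsilon> by (intro order_tendstoD(2)) auto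
  then have "\<forall>\<^sub>F t in at_top. ?\<phi> t < \<epsilon> / 2 \<and> t\<^sub>0 \<le> t"
    using eventually_ge_at_top by (rule eventually_conj)
  then obtain M where M: "?\<phi> M < \<epsilon> / 2" "t\<^sub>0 \<le> M" by (auto dest: eventually_happens)
  \<comment> \<open>Suitable points exist in short intervals by continuity, and intervals can be joined.\<close>
  define P where "P = (\<lambda>a b. t\<^sub>0 \<le> a \<longrightarrow> a \<le> b \<longrightarrow> (\<exists>G. finite G \<and> G \<subseteq> {a..b} \<and> b \<in> G \<and>
    (\<forall>t\<in>{a..b}. \<exists>u\<in>G. \<exists>v\<in>G. u \<le> t \<and> t \<le> v \<and> ?\<phi> u - ?\<phi> v < \<epsilon> / 2)))"
  have "P t\<^sub>0 M" using M(2)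
  proof (induction rule: Bolzano)
    case (trans a b c)
    show ?case unfolding P_def
    proof (intro impI)
      assume "t\<^sub>0 \<le> a"
      then obtain G G' where G: "finite G" "G \<subseteq> {a..b}"
          "\<forall>t\<in>{a..b}. \<exists>u\<in>G. \<exists>v\<in>G. u \<le> t \<and> t \<le> v \<and> ?\<phi> u - ?\<phi> v < \<epsilon> / 2"
        and G': "finite G'" "G' \<subseteq> {b..c}" "c \<in> G'"
          "\<forall>t\<in>{b..c}. \<exists>u\<in>G'. \<exists>v\<in>G'. u \<le> t \<and> t \<le> v \<and> ?\<phi> u - ?\<phi> v < \<epsilon> / 2"
        using trans(1)[unfolded P_def, THEN mp, THEN mp, OF \<open>t\<^sub>0 \<le> a\<close> trans(3)]
          trans(2)[unfolded P_def, THEN mp, THEN mp, OF order_trans[OF \<open>t\<^sub>0 \<le> a\<close> trans(3)] trans(4)]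
        by blast
      show "\<exists>G. finite G \<and> G \<subseteq> {a..c} \<and> c \<in> G \<and>
        (\<forall>t\<in>{a..c}. \<exists>u\<in>G. \<exists>v\<in>G. u \<le> t \<and> t \<le> v \<and> ?\<phi> u - ?\<phi> v < \<epsilon> / 2)"
      proof (intro exI[of _ "G \<union> G'"] conjI ballI)
        fix t assume t: "t \<in> {a..c}"
        show "\<exists>u\<in>G \<union> G'. \<exists>v\<in>G \<union> G'. u \<le> t \<and> t \<le> v \<and> ?\<phi> u - ?\<phi> v < \<epsilon> / 2"
        proof (cases "t \<le> b")
          case True
          then have "t \<in> {a..b}" using t by auto
          then show ?thesis using G(3) by blast
        next
          case False
          then have "t \<in> {b..c}" using t by auto
          then show ?thesis using G'(4) by blast
        qed
      next
        show "G \<union> G' \<subseteq> {a..c}" using G(2) G'(2) trans by fastforce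
      qed (use G(1) G'(1,3) in auto)
    qed
  next
    case (local x)
    have "isCont ?\<phi> x"
      using continuous_on_limit_shape[OF q] t local by (simp add: continuous_on_eq_continuous_at)
    then obtain d where d: "d > 0" "\<And>y. \<bar>y - x\<bar> < d \<Longrightarrow> \<bar>?\<phi> y - ?\<phi> x\<bar> < \<epsilon> / 4"
      using \<epsilon> \<open>isCont ?\<phi> x\<close>[unfolded continuous_at_eps_delta, rule_format, of "\<epsilon> / 4"]
      unfolding dist_real_def by auto
    show ?case
    proof (intro exI[of _ d] conjI allI impI)
      fix a b assume ab: "a \<le> x \<and> x \<le> b \<and> b - a < d"
      then have "\<bar>a - x\<bar> < d" "\<bar>b - x\<bar> < d" by auto
      from this[THEN d(2)] have "?\<phi> a - ?\<phi> b < \<epsilon> / 2" by linarith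
      then show "P a b" unfolding P_def using ab by (intro impI exI[of _ "{a, b}"]) auto
    qed (rule d(1))
  qed
  then obtain G where G: "finite G" "G \<subseteq> {t\<^sub>0..M}" "M \<in> G"
      "\<And>t. t \<in> {t\<^sub>0..M} \<Longrightarrow> \<exists>u\<in>G. \<exists>v\<in>G. u \<le> t \<and> t \<le> v \<and> ?\<phi> u - ?\<phi> v < \<epsilon> / 2"
    using M unfolding P_def by auto
  show ?thesis
  proof (rule that[of G])
    show "\<forall>f t. (\<forall>x y. t\<^sub>0 \<le> x \<longrightarrow> x \<le> y \<longrightarrow> f y \<le> f x) \<longrightarrow> (\<forall>x. 0 \<le> f x) \<longrightarrow> t\<^sub>0 \<le> t \<longrightarrow>
      \<bar>f t - ?\<phi> t\<bar> > \<epsilon> \<longrightarrow> (\<exists>s\<in>G. \<bar>f s - ?\<phi> s\<bar> > \<epsilon> / 2)"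
    proof (intro allI impI)
      fix f :: "real \<Rightarrow> real" and t
      assume anti': "\<forall>x y. t\<^sub>0 \<le> x \<longrightarrow> x \<le> y \<longrightarrow> f y \<le> f x" and nonneg: "\<forall>x. 0 \<le> f x"
        and t0: "t\<^sub>0 \<le> t" and bad: "\<bar>f t - ?\<phi> t\<bar> > \<epsilon>"
      have anti: "f y \<le> f x" if "t\<^sub>0 \<le> x" "x \<le> y" for x y using anti' that by blast
      show "\<exists>s\<in>G. \<bar>f s - ?\<phi> s\<bar> > \<epsilon> / 2"
      proof (cases "t \<le> M")
        case True
        then obtain u v where uv: "u \<in> G" "v \<in> G" "u \<le> t" "t \<le> v" "?\<phi> u - ?\<phi> v < \<epsilon> / 2"
          using G(4)[of t] t0 by auto
        then have "t\<^sub>0 \<le> u" using G by auto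
        then have "f t \<le> f u" "f v \<le> f t" "?\<phi> t \<le> ?\<phi> u" "?\<phi> v \<le> ?\<phi> t"
          using uv t t0 by (auto intro!: anti limit_shape_antimono[OF q])
        then have "\<bar>f u - ?\<phi> u\<bar> > \<epsilon> / 2 \<or> \<bar>f v - ?\<phi> v\<bar> > \<epsilon> / 2"
          using bad uv by linarith
        then show ?thesis using uv by blast
      next
        case False
        then have "f t \<le> f M" "?\<phi> t \<le> ?\<phi> M"
          using M t by (auto intro!: anti limit_shape_antimono[OF q])
        moreover have "0 \<le> ?\<phi> t" using limit_shape_eq_max[OF q, of t] t t0 by simp
        ultimately have "\<bar>f M - ?\<phi> M\<bar> > \<epsilon> / 2"
          using bad M nonneg[rule_format, of t] by linarith
        then show ?thesis using G by blast
      qed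
    qed
  qed (use G in auto)
qed

lemma negligible_deviation:
  assumes gap: "gap_sequence qs" and growth: "linear_growth qs q" and q: "q \<ge> 0"
    and t: "t\<^sub>0 > 0" and \<epsilon>: "\<epsilon> > 0"
  shows "negligible_family qs q
    (\<lambda>z. {p. 0 < z \<and> is_partition p \<and> (\<exists>t\<ge>t\<^sub>0. \<bar>z * young_boundary p (t / z) - limit_shape q t\<bar> > \<epsilon>)})"
proof -
  let ?\<phi> = "limit_shape q"
  obtain G where G: "finite G" "G \<subseteq> {t\<^sub>0..}"
    "\<forall>f t. (\<forall>x y. t\<^sub>0 \<le> x \<longrightarrow> x \<le> y \<longrightarrow> f y \<le> f x) \<longrightarrow> (\<forall>x. 0 \<le> f x) \<longrightarrow> t\<^sub>0 \<le> t \<longrightarrow>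
      \<bar>f t - ?\<phi> t\<bar> > \<epsilon> \<longrightarrow> (\<exists>s\<in>G. \<bar>f s - ?\<phi> s\<bar> > \<epsilon> / 2)"
    by (rule limit_shape_net[OF q t \<epsilon>])
  define S where "S = (\<lambda>s z. {p. z * real (p (nat \<lfloor>s / z\<rfloor>)) > ?\<phi> s + \<epsilon> / 2} \<union>
    {p. 0 \<le> z \<and> z * real (p (nat \<lfloor>s / z\<rfloor>)) < ?\<phi> s - \<epsilon> / 2})"
  have "negligible_family qs q (\<lambda>z. \<Union>s\<in>G. S s z)"
  proof (rule negligible_family_UN[OF G(1)])
    fix s assume "s \<in> G"
    then have "s > 0" using G t by auto
    then show "negligible_family qs q (S s)"
      unfolding S_def using \<epsilon>
      by (intro negligible_family_Un negligible_above negligible_below gap growth q) auto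
  qed
  moreover have "{p. 0 < z \<and> is_partition p \<and> (\<exists>t\<ge>t\<^sub>0. \<bar>z * young_boundary p (t / z) - ?\<phi> t\<bar> > \<epsilon>)}
      \<subseteq> (\<Union>s\<in>G. S s z)" for z
  proof
    fix p assume "p \<in> {p. 0 < z \<and> is_partition p \<and> (\<exists>t\<ge>t\<^sub>0. \<bar>z * young_boundary p (t / z) - ?\<phi> t\<bar> > \<epsilon>)}"
    then obtain t where z: "0 < z" and p: "is_partition p"
      and dev: "t\<^sub>0 \<le> t" "\<bar>z * young_boundary p (t / z) - ?\<phi> t\<bar> > \<epsilon>" by blast
    have "\<exists>s\<in>G. \<bar>z * young_boundary p (s / z) - ?\<phi> s\<bar> > \<epsilon> / 2"
    proof (rule G(3)[rule_format, of "\<lambda>t. z * young_boundary p (t / z)" t])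
      fix x y :: real assume "x \<le> y"
      then have "nat \<lfloor>x / z\<rfloor> \<le> nat \<lfloor>y / z\<rfloor>" using z by (intro nat_mono floor_mono divide_right_mono) auto
      then have "p (nat \<lfloor>y / z\<rfloor>) \<le> p (nat \<lfloor>x / z\<rfloor>)"
        using p by (auto simp: is_partition_def dest: antimonoD)
      then show "z * young_boundary p (y / z) \<le> z * young_boundary p (x / z)"
        using z by (simp add: young_boundary_def)
    next
      show "0 \<le> z * young_boundary p (x / z)" for x using z by (simp add: young_boundary_def)
    qed (fact dev)+
    then obtain s where "s \<in> G" "\<bar>z * real (p (nat \<lfloor>s / z\<rfloor>)) - ?\<phi> s\<bar> > \<epsilon> / 2"
      by (auto simp: young_boundary_def)
    moreover from this have "z * real (p (nat \<lfloor>s / z\<rfloor>)) > ?\<phi> s + \<epsilon> / 2 \<or>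
        z * real (p (nat \<lfloor>s / z\<rfloor>)) < ?\<phi> s - \<epsilon> / 2" by linarith
    then have "p \<in> S s z" using z by (auto simp: S_def)
    ultimately show "p \<in> (\<Union>s\<in>G. S s z)" by blast
  qed
  ultimately show ?thesis by (rule negligible_family_subset)
qed

section \<open>The number of partitions of a given weight\<close>

lemma sum_weight_change_le:
  assumes "\<And>p. p \<in> X \<Longrightarrow> b \<le> (z' - z) * real (part_weight p)"
  shows "(\<Sum>p\<in>X. tilted_weight z' 0 0 p) \<le> exp (- b) * (\<Sum>p\<in>X. tilted_weight z 0 0 p)"
  unfolding sum_distrib_left
proof (rule sum_mono)
  fix p assume "p \<in> X"
  then have "b \<le> (z' - z) * real (part_weight p)" using assms by simp
  then show "tilted_weight z' 0 0 p \<le> exp (- b) * tilted_weight z 0 0 p"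
    by (simp add: tilted_weight_def exp_add[symmetric] algebra_simps)
qed

lemma card_gap_partitions_of_range_le:
  assumes gap: "gap_sequence qs" and X: "X \<subseteq> gap_partitions qs"
    and w: "\<And>p. p \<in> X \<Longrightarrow> 1 \<le> part_weight p \<and> part_weight p \<le> n"
  shows "card X \<le> n * card (gap_partitions_of qs n)"
proof -
  have "card X \<le> card (\<Union>m\<in>{1..n}. gap_partitions_of qs m)"
    using X w by (intro card_mono finite_UN_I finite_gap_partitions_of)
      (auto simp: gap_partitions_of_def)
  also have "\<dots> \<le> (\<Sum>m\<in>{1..n}. card (gap_partitions_of qs m))" by (intro card_UN_le) simp
  also have "\<dots> \<le> (\<Sum>m\<in>{1..n}. card (gap_partitions_of qs n))"
    using gap by (intro sum_mono card_gap_partitions_of_mono) auto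
  finally show ?thesis by simp
qed

text \<open>Arithmetic for the next lemma, in units of \<open>u = \<vartheta>\<^sub>q sqrt n\<close>.  At \<open>z = (1 + h) \<vartheta>\<^sub>q / sqrt n\<close> the full sum has
  exponent at least \<open>(1 - \<kappa>) / (1 + h)\<close>.  The first two inequalities say that weights above \<open>n\<close> and
  below \<open>(1 - 4 h) n\<close> contribute exponentially less; the third evaluates what is left.  The gain is of
  order \<open>h\<^sup>2\<close>, the second-order term of \<open>1 / (1 + h)\<close>, which is why the error \<open>\<kappa>\<close> is a small multiple
  of \<open>h\<^sup>2\<close>.\<close>

lemma window_exponents:
  fixes h :: real
  assumes h: "0 < h" "h \<le> 1 / 8"
  defines "\<kappa> \<equiv> h\<^sup>2 / 8"
  shows "- h + (1 + \<kappa>) \<le> (1 - \<kappa>) / (1 + h) - h\<^sup>2 / 4"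
    and "h * (1 - 4 * h) + (1 + \<kappa>) / (1 + 2 * h) \<le> (1 - \<kappa>) / (1 + h) - h\<^sup>2 / 4"
    and "2 - 6 * h \<le> (1 - \<kappa>) / (1 + h) + (1 + h) * (1 - 4 * h)"
proof -
  have \<kappa>: "0 \<le> \<kappa>" "\<kappa> = h\<^sup>2 / 8" by (simp_all add: \<kappa>_def)
  have \<kappa>h: "\<kappa> \<le> h / 8" using h by (simp add: \<kappa>_def power2_eq_square mult_left_le)
  have h2: "h\<^sup>2 \<le> h / 8" using h by (simp add: power2_eq_square mult_left_mono)
  have base: "1 / (1 + h) - \<kappa> \<le> (1 - \<kappa>) / (1 + h)"
  proof -
    have "\<kappa> / (1 + h) \<le> \<kappa> / 1" using h \<kappa>(1) by (intro divide_left_mono) auto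
    then show ?thesis by (simp add: diff_divide_distrib)
  qed
  have "1 - h + h\<^sup>2 / 2 \<le> 1 / (1 + h)"
  proof -
    have "h\<^sup>2 * h \<le> h\<^sup>2 * 1" using h by (intro mult_left_mono) auto
    then have "(1 - h + h\<^sup>2 / 2) * (1 + h) \<le> 1"
      by (simp add: power2_eq_square algebra_simps)
    then show ?thesis using h by (simp add: le_divide_eq)
  qed
  note inv = this
  show "- h + (1 + \<kappa>) \<le> (1 - \<kappa>) / (1 + h) - h\<^sup>2 / 4"
    using base inv \<kappa> by linarith
  have "h * (1 - 4 * h) + 1 / (1 + 2 * h) \<le> 1 / (1 + h) - h\<^sup>2"
  proof -
    have "(1 - 3 * h) * ((1 + h) * (1 + 2 * h)) \<le> 1"
    proof -
      have "0 \<le> h\<^sup>2 * (7 + 6 * h)" using h by simp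
      then show ?thesis by (simp add: power2_eq_square algebra_simps)
    qed
    then have "1 - 3 * h \<le> 1 / ((1 + h) * (1 + 2 * h))"
      using h by (subst le_divide_eq) auto
    then have "h * (1 - 3 * h) \<le> h * (1 / ((1 + h) * (1 + 2 * h)))"
      using h by (intro mult_left_mono) auto
    also have "\<dots> = 1 / (1 + h) - 1 / (1 + 2 * h)"
      using h by (simp add: divide_simps)
    finally show ?thesis by (simp add: power2_eq_square algebra_simps)
  qed
  moreover have "(1 + \<kappa>) / (1 + 2 * h) \<le> 1 / (1 + 2 * h) + \<kappa>"
  proof -
    have "\<kappa> / (1 + 2 * h) \<le> \<kappa> / 1" using h \<kappa>(1) by (intro divide_left_mono) auto
    then show ?thesis by (simp add: add_divide_distrib)
  qed
  ultimately show "h * (1 - 4 * h) + (1 + \<kappa>) / (1 + 2 * h) \<le> (1 - \<kappa>) / (1 + h) - h\<^sup>2 / 4"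
    using base \<kappa> by linarith
  have "(1 + h) * (1 - 4 * h) = 1 - 3 * h - 4 * h\<^sup>2" by (simp add: power2_eq_square algebra_simps)
  then show "2 - 6 * h \<le> (1 - \<kappa>) / (1 + h) + (1 + h) * (1 - 4 * h)"
    using base inv \<kappa>h h2 h(1) zero_le_power2[of h] by linarith
qed

lemma filterlim_const_over_sqrt:
  assumes "b > 0"
  shows "filterlim (\<lambda>n::nat. b / sqrt (real n)) (at_right 0) sequentially"
  using assms by real_asymp

text \<open>The sum at the parameter \<open>(1 + h) z\<close> with \<open>z = \<vartheta>\<^sub>q / sqrt n\<close> is centred at weights slightly below \<open>n\<close>.
  Comparing it with the sums at \<open>z\<close> and at \<open>(1 + 2 h) z\<close> shows that half of it comes from weights
  between \<open>(1 - 4 h) n\<close> and \<open>n\<close>.  By monotonicity each of these weights is attained by at most as many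
  partitions as \<open>n\<close> is.\<close>

lemma card_gap_partitions_of_ge:
  assumes gap: "gap_sequence qs" and growth: "linear_growth qs q" and q: "q \<ge> 0" and \<gamma>: "\<gamma> > 0"
  shows "\<forall>\<^sub>F n in sequentially.
    exp ((2 - \<gamma>) * (theta q * sqrt (real n))) \<le> real (card (gap_partitions_of qs n))"
proof -
  \<comment> \<open>The window costs \<open>6 h\<close> in the exponent, and the factor \<open>2 n\<close> is absorbed by another \<open>h\<close>.\<close>
  define h where "h = min (1 / 8) (\<gamma> / 7)"
  have h: "0 < h" "h \<le> 1 / 8" "7 * h \<le> \<gamma>" using \<gamma> by (auto simp: h_def)
  define \<kappa> where "\<kappa> = h\<^sup>2 / 8"
  have \<kappa>: "\<kappa> > 0" using h by (simp add: \<kappa>_def)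
  note we = window_exponents[OF h(1,2), folded \<kappa>_def]
  let ?\<theta> = "theta q"
  have \<theta>: "?\<theta> > 0" using theta_pos[OF q] .
  define \<eta> where "\<eta> = ?\<theta>\<^sup>2 * \<kappa>"
  have \<eta>: "\<eta> > 0" using \<theta> \<kappa> by (simp add: \<eta>_def)
  define W where "W = (\<lambda>z X. \<Sum>p\<in>X. tilted_weight z 0 0 p)"
  define z where "z = (\<lambda>c n. c * ?\<theta> / sqrt (real n))"
  have lim: "filterlim (z c) (at_right 0) sequentially" if "c > 0" for c
    unfolding z_def using that \<theta> by (intro filterlim_const_over_sqrt) simp
  have upper: "\<forall>\<^sub>F n in sequentially. \<forall>X. finite X \<longrightarrow> X \<subseteq> gap_partitions qs \<longrightarrow>
      W (z c n) X \<le> exp ((?\<theta>\<^sup>2 + \<eta>) / z c n)" if "c > 0" for c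
    unfolding W_def using eventually_compose_filterlim[OF total_sum_le[OF gap growth q \<eta>] lim[OF that]] .
  have lower: "\<forall>\<^sub>F n in sequentially. \<exists>X. finite X \<and> X \<subseteq> gap_partitions qs \<and>
      exp ((?\<theta>\<^sup>2 - \<eta>) / z (1 + h) n) \<le> W (z (1 + h) n) X"
    unfolding W_def using h eventually_compose_filterlim[OF total_sum_ge[OF gap growth q \<eta>] lim[of "1 + h"]]
    by simp
  have exp_ge: "\<forall>\<^sub>F n::nat in sequentially. 4 \<le> exp (b * sqrt (real n))"
    "\<forall>\<^sub>F n::nat in sequentially. 2 * real n \<le> exp (b * sqrt (real n))" if "b > 0" for b :: real
    using that by real_asymp+
  have "0 < h\<^sup>2 / 4 * ?\<theta>" "0 < h * ?\<theta>" using h \<theta> by simp_all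
  note exp_ge = exp_ge(1)[OF this(1)] exp_ge(2)[OF this(2)]
  have "(1::real) > 0" "1 + 2 * h > 0" using h by auto
  note upper = this[THEN upper]
  from exp_ge upper lower eventually_gt_at_top[of 0] show ?thesis
  proof eventually_elim
    case (elim n)
    define u where "u = ?\<theta> * sqrt (real n)"
    have u: "u > 0" using \<theta> elim by (simp add: u_def)
    have zn: "z c n * real n = c * u" for c
      using elim by (simp add: z_def u_def field_simps)
    have zinv: "(?\<theta>\<^sup>2 + b * \<eta>) / z c n = u * ((1 + b * \<kappa>) / c)" if "c > 0" for b c
    proof -
      have "?\<theta>\<^sup>2 + b * \<eta> = ?\<theta>\<^sup>2 * (1 + b * \<kappa>)" by (simp add: \<eta>_def algebra_simps)
      then show ?thesis using that \<theta> elim by (simp add: z_def u_def power2_eq_square field_simps)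
    qed
    have h1: "1 + h > 0" "1 + 2 * h > 0" using h by auto
    obtain X where X: "finite X" "X \<subseteq> gap_partitions qs"
      "exp ((?\<theta>\<^sup>2 - \<eta>) / z (1 + h) n) \<le> W (z (1 + h) n) X" using elim by blast
    have cancel_exp: "a * exp w \<le> b" if "a \<le> b * exp (- w)" for a b w :: real
      using that by (simp add: exp_minus field_simps)
    define m where "m = (1 - \<kappa>) / (1 + h)"
    have total: "exp (u * m) \<le> W (z (1 + h) n) X"
      using X(3) zinv[OF h1(1), of "- 1"] by (simp add: m_def)
    define Hi where "Hi = {p \<in> X. n < part_weight p}"
    define Lo where "Lo = {p \<in> X. real (part_weight p) < real n * (1 - 4 * h)}"
    define Mid where "Mid = {p \<in> X. real n * (1 - 4 * h) \<le> real (part_weight p) \<and> part_weight p \<le> n}"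
    have fin: "finite Hi" "finite Lo" "finite Mid"
      and sub: "Hi \<subseteq> gap_partitions qs" "Lo \<subseteq> gap_partitions qs" "Mid \<subseteq> gap_partitions qs"
      using X by (auto simp: Hi_def Lo_def Mid_def)
    have W_nonneg: "W c Y \<ge> 0" for c Y by (auto simp: W_def tilted_weight_def intro!: sum_nonneg)
    have "X \<subseteq> Hi \<union> Lo \<union> Mid" by (auto simp: Hi_def Lo_def Mid_def)
    then have "W (z (1 + h) n) X \<le> W (z (1 + h) n) (Hi \<union> Lo \<union> Mid)"
      unfolding W_def using fin by (intro sum_mono2) (auto simp: tilted_weight_def)
    also have "\<dots> \<le> W (z (1 + h) n) (Hi \<union> Lo) + W (z (1 + h) n) Mid"
      using sum.union_inter[of "Hi \<union> Lo" Mid] fin W_nonneg unfolding W_def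
      by (metis finite_UnI le_add_same_cancel1)
    also have "W (z (1 + h) n) (Hi \<union> Lo) \<le> W (z (1 + h) n) Hi + W (z (1 + h) n) Lo"
      using sum.union_inter[of Hi Lo] fin W_nonneg unfolding W_def
      by (metis le_add_same_cancel1)
    finally have split: "W (z (1 + h) n) X \<le> W (z (1 + h) n) Hi + W (z (1 + h) n) Lo + W (z (1 + h) n) Mid"
      by simp
    define B where "B = exp (u * (m - h\<^sup>2 / 4))"
    have Hi: "W (z (1 + h) n) Hi \<le> B"
    proof -
      have "W (z (1 + h) n) Hi \<le> exp (- (h * u)) * W (z 1 n) Hi"
        unfolding W_def
      proof (rule sum_weight_change_le)
        fix p assume "p \<in> Hi"
        then have "real n \<le> real (part_weight p)" by (simp add: Hi_def)
        then have "h * ?\<theta> / sqrt (real n) * real n \<le> h * ?\<theta> / sqrt (real n) * real (part_weight p)"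
          using h \<theta> by (intro mult_left_mono) auto
        moreover have "h * ?\<theta> / sqrt (real n) * real n = h * u" using zn[of h] by (simp add: z_def)
        moreover have "z (1 + h) n - z 1 n = h * ?\<theta> / sqrt (real n)"
          by (simp add: z_def add_divide_distrib distrib_right)
        ultimately show "h * u \<le> (z (1 + h) n - z 1 n) * real (part_weight p)" by simp
      qed
      also have "\<dots> \<le> exp (- (h * u)) * exp (u * (1 + \<kappa>))"
        using elim(3) fin sub zinv[of 1 1] by (intro mult_left_mono) auto
      also have "\<dots> = exp (u * (- h + (1 + \<kappa>)))" by (simp add: exp_add[symmetric] algebra_simps)
      also have "\<dots> \<le> B" unfolding B_def m_def using u we(1) by (simp add: mult_left_mono)
      finally show ?thesis .
    qed
    have Lo: "W (z (1 + h) n) Lo \<le> B"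
    proof -
      have "W (z (1 + h) n) Lo \<le> exp (- (- (h * u * (1 - 4 * h)))) * W (z (1 + 2 * h) n) Lo"
        unfolding W_def
      proof (rule sum_weight_change_le)
        fix p assume "p \<in> Lo"
        then have "real (part_weight p) \<le> real n * (1 - 4 * h)" by (simp add: Lo_def)
        then have "h * ?\<theta> / sqrt (real n) * real (part_weight p) \<le> h * ?\<theta> / sqrt (real n) * (real n * (1 - 4 * h))"
          using h \<theta> by (intro mult_left_mono) auto
        also have "\<dots> = z h n * real n * (1 - 4 * h)" by (simp add: z_def)
        also have "\<dots> = h * u * (1 - 4 * h)" by (simp only: zn)
        finally have "h * ?\<theta> / sqrt (real n) * real (part_weight p) \<le> h * u * (1 - 4 * h)" .
        moreover have "z (1 + h) n - z (1 + 2 * h) n = - (h * ?\<theta> / sqrt (real n))"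
          by (simp add: z_def add_divide_distrib distrib_right)
        ultimately show "- (h * u * (1 - 4 * h)) \<le> (z (1 + h) n - z (1 + 2 * h) n) * real (part_weight p)"
          by simp
      qed
      also have "\<dots> \<le> exp (- (- (h * u * (1 - 4 * h)))) * exp (u * ((1 + \<kappa>) / (1 + 2 * h)))"
        using elim(4) fin sub zinv[OF h1(2), of 1] by (intro mult_left_mono) auto
      also have "\<dots> = exp (u * (h * (1 - 4 * h) + (1 + \<kappa>) / (1 + 2 * h)))"
        by (simp add: exp_add[symmetric] algebra_simps)
      also have "\<dots> \<le> B" unfolding B_def m_def using u we(2) by (simp add: mult_left_mono)
      finally show ?thesis .
    qed
    have "4 * B \<le> exp (h\<^sup>2 / 4 * ?\<theta> * sqrt (real n)) * B"
      using elim(1) by (intro mult_right_mono) (auto simp: B_def)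
    also have "\<dots> = exp (u * m)"
      by (simp add: B_def u_def exp_add[symmetric] algebra_simps)
    finally have "exp (u * m) / 2 \<le> W (z (1 + h) n) Mid"
      using total split Hi Lo by linarith
    also have "\<dots> \<le> (\<Sum>p\<in>Mid. exp (- ((1 + h) * u * (1 - 4 * h))))"
      unfolding W_def
    proof (rule sum_mono)
      fix p assume "p \<in> Mid"
      then have "real n * (1 - 4 * h) \<le> real (part_weight p)" by (simp add: Mid_def)
      then have "z (1 + h) n * (real n * (1 - 4 * h)) \<le> z (1 + h) n * real (part_weight p)"
        using h \<theta> by (intro mult_left_mono) (auto simp: z_def)
      moreover have "z (1 + h) n * (real n * (1 - 4 * h)) = (1 + h) * u * (1 - 4 * h)"
        using zn[of "1 + h"] by (simp add: mult.assoc[symmetric])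
      ultimately show "tilted_weight (z (1 + h) n) 0 0 p \<le> exp (- ((1 + h) * u * (1 - 4 * h)))"
        by (simp add: tilted_weight_def)
    qed
    also have "\<dots> = real (card Mid) * exp (- ((1 + h) * u * (1 - 4 * h)))" by simp
    also have "\<dots> \<le> (real n * real (card (gap_partitions_of qs n))) * exp (- ((1 + h) * u * (1 - 4 * h)))"
    proof (intro mult_right_mono)
      have "card Mid \<le> n * card (gap_partitions_of qs n)"
      proof (rule card_gap_partitions_of_range_le[OF gap sub(3)])
        fix p assume p: "p \<in> Mid"
        have "0 < real n * (1 - 4 * h)" using h elim by simp
        then have "0 < real (part_weight p)" using p by (auto simp: Mid_def)
        then show "1 \<le> part_weight p \<and> part_weight p \<le> n" using p by (auto simp: Mid_def)
      qed
      then show "real (card Mid) \<le> real n * real (card (gap_partitions_of qs n))"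
        by (simp flip: of_nat_mult)
    qed simp
    finally have "exp (u * m) / 2 \<le>
        (real n * real (card (gap_partitions_of qs n))) * exp (- ((1 + h) * u * (1 - 4 * h)))" .
    from cancel_exp[OF this] have "exp (u * m) * exp ((1 + h) * u * (1 - 4 * h)) \<le>
        2 * real n * real (card (gap_partitions_of qs n))" by simp
    also have "\<dots> \<le> exp (h * ?\<theta> * sqrt (real n)) * real (card (gap_partitions_of qs n))"
      using elim(2) by (intro mult_right_mono) auto
    finally have "exp (u * m) * exp ((1 + h) * u * (1 - 4 * h)) \<le>
        real (card (gap_partitions_of qs n)) * exp (- (- (h * u)))"
      by (simp add: u_def mult_ac)
    note cancel_exp[OF this]
    moreover have "exp ((2 - \<gamma>) * u) \<le> exp (u * m) * exp ((1 + h) * u * (1 - 4 * h)) * exp (- (h * u))"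
    proof -
      have "u * (2 - \<gamma>) \<le> u * (m + (1 + h) * (1 - 4 * h) - h)"
        using we(3) h u unfolding m_def by (intro mult_left_mono) auto
      then show ?thesis by (simp add: exp_add[symmetric] algebra_simps)
    qed
    ultimately show ?case unfolding u_def by linarith
  qed
qed

text \<open>All partitions of \<open>n\<close> have the same Boltzmann weight \<open>exp (- \<vartheta>\<^sub>q sqrt n)\<close> at \<open>z = \<vartheta>\<^sub>q / sqrt n\<close>, and
  \<open>\<vartheta>\<^sub>q\<^sup>2 / z\<close> is \<open>\<vartheta>\<^sub>q sqrt n\<close> as well.\<close>

lemma negligible_family_card_le:
  assumes q: "q \<ge> 0" and S: "negligible_family qs q S"
  shows "\<exists>c>0. \<forall>\<^sub>F n in sequentially.
    real (card (gap_partitions_of qs n \<inter> S (theta q / sqrt (real n)))) \<le> exp ((2 - c) * (theta q * sqrt (real n)))"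
proof -
  let ?\<theta> = "theta q"
  have \<theta>: "?\<theta> > 0" using theta_pos[OF q] .
  obtain c where c: "c > 0" and ev: "\<forall>\<^sub>F z in at_right 0. \<forall>X. finite X \<longrightarrow> X \<subseteq> gap_partitions qs \<inter> S z \<longrightarrow>
     (\<Sum>p\<in>X. tilted_weight z 0 0 p) \<le> exp ((?\<theta>\<^sup>2 - c) / z)"
    using S unfolding negligible_family_def by blast
  from eventually_compose_filterlim[OF ev filterlim_const_over_sqrt[OF \<theta>]] eventually_gt_at_top[of 0]
  have "\<forall>\<^sub>F n in sequentially.
    real (card (gap_partitions_of qs n \<inter> S (?\<theta> / sqrt (real n)))) \<le> exp ((2 - c / ?\<theta>\<^sup>2) * (?\<theta> * sqrt (real n)))"
  proof eventually_elim
    case (elim n)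
    define z where "z = ?\<theta> / sqrt (real n)"
    let ?X = "gap_partitions_of qs n \<inter> S z"
    have zn: "z * real n = ?\<theta> * sqrt (real n)"
      using elim by (simp add: z_def field_simps)
    have "(\<Sum>p\<in>?X. tilted_weight z 0 0 p) \<le> exp ((?\<theta>\<^sup>2 - c) / z)"
      by (rule elim(1)[folded z_def, rule_format])
        (auto simp: finite_gap_partitions_of, auto simp: gap_partitions_of_def)
    moreover have "(\<Sum>p\<in>?X. tilted_weight z 0 0 p) = (\<Sum>p\<in>?X. exp (- (?\<theta> * sqrt (real n))))"
      by (intro sum.cong refl) (auto simp: tilted_weight_def gap_partitions_of_def zn)
    ultimately have "real (card ?X) * exp (- (?\<theta> * sqrt (real n))) \<le> exp ((?\<theta>\<^sup>2 - c) / z)" by simp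
    then have "real (card ?X) \<le> exp ((?\<theta>\<^sup>2 - c) / z) * exp (?\<theta> * sqrt (real n))"
      by (simp add: exp_minus field_simps)
    also have "\<dots> = exp ((?\<theta>\<^sup>2 - c) / z + ?\<theta> * sqrt (real n))" by (simp add: exp_add)
    also have "(?\<theta>\<^sup>2 - c) / z + ?\<theta> * sqrt (real n) = (2 - c / ?\<theta>\<^sup>2) * (?\<theta> * sqrt (real n))"
      using \<theta> elim by (simp add: z_def field_simps power2_eq_square)
    finally show ?case unfolding z_def .
  qed
  moreover have "c / ?\<theta>\<^sup>2 > 0" using c \<theta> by simp
  ultimately show ?thesis by blast
qed

section \<open>Exponential concentration around the limit shape\<close>

theorem theorem4p4:
  fixes qs :: "nat \<Rightarrow> nat" and q \<beta> t\<^sub>0 \<epsilon> \<delta> :: real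
  assumes "gap_sequence qs"
    and "q \<ge> 0" and "0 \<le> \<beta>" and "\<beta> < 1"
    and "(\<lambda>k. real (\<Sum>i<k. qs i) - q * real k) \<in> O(\<lambda>k. real k powr \<beta>)"
    and "t\<^sub>0 > 0" and "\<epsilon> > 0" and "\<delta> > 0"
  defines "z \<equiv> \<lambda>n::nat. theta q / sqrt (real n)"
  shows "limsup (\<lambda>n. ereal (real n powr (\<delta> - 1 / 2)) *
           ereal_log (measure_pmf.prob (gap_measure qs n)
             {p \<in> gap_partitions_of qs n.
                (SUP t\<in>{t\<^sub>0..}. ereal \<bar>z n * young_boundary p (t / z n) - limit_shape q t\<bar>)
                  > ereal \<epsilon>})) < 0"
proof -
  let ?\<theta> = "theta q"
  let ?Bad = "\<lambda>n. {p \<in> gap_partitions_of qs n.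
    (SUP t\<in>{t\<^sub>0..}. ereal \<bar>z n * young_boundary p (t / z n) - limit_shape q t\<bar>) > ereal \<epsilon>}"
  have \<theta>: "?\<theta> > 0" using theta_pos[OF \<open>q \<ge> 0\<close>] .
  have growth: "linear_growth qs q" by (rule linear_growthI) fact+
  define S where "S = (\<lambda>z. {p. 0 < z \<and> is_partition p \<and>
    (\<exists>t\<ge>t\<^sub>0. \<bar>z * young_boundary p (t / z) - limit_shape q t\<bar> > \<epsilon>)})"
  have "negligible_family qs q S"
    unfolding S_def using assms growth by (intro negligible_deviation)
  then obtain c where c: "c > 0"
    and bad: "\<forall>\<^sub>F n in sequentially. real (card (gap_partitions_of qs n \<inter> S (z n)))
      \<le> exp ((2 - c) * (?\<theta> * sqrt (real n)))"
    using negligible_family_card_le[OF \<open>q \<ge> 0\<close>] unfolding z_def by blast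
  have "c / 2 > 0" using c by simp
  from bad card_gap_partitions_of_ge[OF \<open>gap_sequence qs\<close> growth \<open>q \<ge> 0\<close> this] eventually_gt_at_top[of 0]
  have "\<forall>\<^sub>F n in sequentially. ereal (real n powr (\<delta> - 1 / 2)) *
      ereal_log (measure_pmf.prob (gap_measure qs n) (?Bad n)) \<le> ereal (- (c * ?\<theta> / 2))"
  proof eventually_elim
    case (elim n)
    let ?L = "gap_partitions_of qs n" and ?u = "?\<theta> * sqrt (real n)"
    let ?P = "measure_pmf.prob (gap_measure qs n) (?Bad n)"
    have z: "z n > 0" using elim \<theta> by (simp add: z_def)
    have "0 < real (card ?L)" by (rule less_le_trans[OF exp_gt_zero elim(2)])
    then have ne: "?L \<noteq> {}" by auto
    have "?Bad n \<subseteq> ?L \<inter> S (z n)"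
      using z by (auto simp: S_def less_SUP_iff gap_partitions_of_def gap_partitions_def)
    then have "card (?Bad n) \<le> card (?L \<inter> S (z n))"
      by (intro card_mono) (auto simp: finite_gap_partitions_of)
    then have num: "real (card (?Bad n)) \<le> exp ((2 - c) * ?u)" using elim(1) by linarith
    have "?P = real (card (?L \<inter> ?Bad n)) / real (card ?L)"
      unfolding gap_measure_def using ne finite_gap_partitions_of by (intro measure_pmf_of_set)
    also have "?L \<inter> ?Bad n = ?Bad n" by blast
    also have "real (card (?Bad n)) / real (card ?L) \<le> exp ((2 - c) * ?u) / exp ((2 - c / 2) * ?u)"
      using num elim(2) by (intro frac_le) auto
    also have "\<dots> = exp (- (c / 2 * ?u))"
      by (simp add: exp_diff[symmetric] algebra_simps)
    finally have P: "?P \<le> exp (- (c / 2 * ?u))" .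
    show ?case
    proof (cases "?P = 0")
      case True
      then show ?thesis using elim(3) by (simp add: ereal_log_def)
    next
      case False
      then have pos: "?P > 0" using measure_nonneg[of "measure_pmf (gap_measure qs n)" "?Bad n"] by linarith
      then have "ln ?P \<le> ln (exp (- (c / 2 * ?u)))" using P by (subst ln_le_cancel_iff) auto
      then have "ln ?P \<le> - (c / 2 * ?u)" by simp
      then have "real n powr (\<delta> - 1 / 2) * ln ?P \<le> real n powr (\<delta> - 1 / 2) * (- (c / 2 * ?u))"
        by (intro mult_left_mono) auto
      also have "\<dots> = - (c * ?\<theta> / 2) * (real n powr (\<delta> - 1 / 2) * real n powr (1 / 2))"
        using elim(3) by (simp add: powr_half_sqrt)
      also have "\<dots> = - (c * ?\<theta> / 2) * real n powr \<delta>" by (simp flip: powr_add)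
      also have "\<dots> \<le> - (c * ?\<theta> / 2) * 1"
        using c \<theta> elim(3) \<open>\<delta> > 0\<close> by (intro mult_left_mono_neg ge_one_powr_ge_zero) auto
      finally show ?thesis using False by (simp add: ereal_log_def)
    qed
  qed
  then have "limsup (\<lambda>n. ereal (real n powr (\<delta> - 1 / 2)) *
      ereal_log (measure_pmf.prob (gap_measure qs n) (?Bad n))) \<le> ereal (- (c * ?\<theta> / 2))"
    by (rule Limsup_bounded)
  also have "\<dots> < 0" using c \<theta> by simp
  finally show ?thesis .
qed

end
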